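(* Let $n\ge1$, $m\ge0$, and let $M^{n+1}=[a,+\infty)\times\mathbb{S}^n$ carry the anti-de Sitter–Schwarzschild metric $\bar g=dr^2+\lambda^2(r)g_{\mathbb{S}^n}$, where $\lambda$ satisfies $\lambda'(r)=\sqrt{1+\lambda^2-m\lambda^{1-n}}$ and $a$ satisfies $\lambda(a)=m^{\frac1{n+1}}$. Let $\Sigma$ be a star-shaped $C^1$ hypersurface in $M^{n+1}$ and $\Omega$ the domain bounded by $\Sigma$ and $\{a\}\times\mathbb{S}^n$. Then $$\Big(\int_\Sigma\lambda'(r)\,d\mu\Big)^2\ge\Big((n+1)\widehat\eta\Big(\int_\Omega\lambda'(r)\,dv\Big)+\frac{m(n+1)}{2}\int_\Omega\frac{\lambda'(r)}{\lambda^n(r)\sqrt{(\lambda'(r))^2-1}}\,dv\Big)^2+\Big((n+1)\omega_n^{\frac1n}\int_\Omega\lambda'(r)\,dv+\omega_n^{\frac{n+1}{n}}m\Big)^{\frac{2n}{n+1}},$$ where $\widehat\eta$ is determined by $$\widehat\eta\Big(\omega_n\int_{m^{1/(n+1)}}^t s^n\,ds\Big)=\omega_n\int_{m^{1/(n+1)}}^t\Lambda(s)s^n\,ds\qquad\forall\,t\ge m^{\frac1{n+1}},$$ with $\Lambda(t):=\frac{\sqrt{\Psi^2(t)-1}}{t}$ and $\Psi(t):=\lambda'\circ\lambda^{-1}(t)$. Equality holds if and only if $\Sigma$ is a radial coordinate slice $\{r_0\}\times\mathbb{S}^n$ with $r_0\in[a,+\infty)$.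
   Context: A hypersurface $\Sigma\subset M^{n+1}$ is star-shaped ($C^1$) if it can be written as $\Sigma=\{(r(\theta),\theta):\theta\in\mathbb{S}^n\}$ for a $C^1$ function $r$ on $\mathbb{S}^n$ with $r(\theta)\ge a$. $dv=\lambda^n dr\,d\sigma$ is the volume element ($d\sigma$ the area element of $\mathbb{S}^n$), $d\mu$ the induced area element of $\Sigma$, and $\omega_n$ the area of $\mathbb{S}^n$. *)

theory Defs
  imports "HOL-Analysis.Analysis"
begin

text \<open>The unit sphere S^n is realised as sphere 0 1 in a Euclidean space 'a
  with DIM('a) = n+1.  Integration against the round area element d sigma is
  defined through the cone (polar-coordinate) formula:
  integral over S^n of f d sigma = (n+1) * integral over the unit ball of f(x/|x|) dx.\<close>
definition sphere_int :: "('a::euclidean_space \<Rightarrow> real) \<Rightarrow> real" where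
  "sphere_int f = real DIM('a) * integral (ball 0 1) (\<lambda>x. f (x /\<^sub>R norm x))"

definition omega :: "'a::euclidean_space itself \<Rightarrow> real" where
  "omega _ = sphere_int (\<lambda>_::'a. 1)"

definition lam_d :: "real \<Rightarrow> nat \<Rightarrow> (real \<Rightarrow> real) \<Rightarrow> real \<Rightarrow> real" where
  "lam_d m n lam r = sqrt (1 + (lam r)\<^sup>2 - m * (lam r) powr (1 - real n))"

definition Psi :: "real \<Rightarrow> nat \<Rightarrow> (real \<Rightarrow> real) \<Rightarrow> real \<Rightarrow> real \<Rightarrow> real" where
  "Psi m n lam a t = lam_d m n lam (the_inv_into {a..} lam t)"

definition Lam :: "real \<Rightarrow> nat \<Rightarrow> (real \<Rightarrow> real) \<Rightarrow> real \<Rightarrow> real \<Rightarrow> real" where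
  "Lam m n lam a t = sqrt ((Psi m n lam a t)\<^sup>2 - 1) / t"

text \<open>Integral over Sigma = {(r(theta),theta)} of f(r) d mu, with
  d mu = lambda(r)^(n-1) sqrt(lambda(r)^2 + |grad r|^2) d sigma;
  Dr is the gradient of the 0-homogeneous extension of r (= spherical gradient).\<close>
definition surf_int :: "nat \<Rightarrow> (real \<Rightarrow> real) \<Rightarrow> ('a::euclidean_space \<Rightarrow> real)
     \<Rightarrow> ('a \<Rightarrow> 'a) \<Rightarrow> (real \<Rightarrow> real) \<Rightarrow> real" where
  "surf_int n lam r Dr f = sphere_int (\<lambda>\<theta>. f (r \<theta>) * (lam (r \<theta>)) ^ (n - 1)
       * sqrt ((lam (r \<theta>))\<^sup>2 + (norm (Dr \<theta>))\<^sup>2))"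

text \<open>Integral over Omega = {(s,theta) : a <= s <= r(theta)} of f(s) dv, dv = lambda^n ds d sigma.\<close>
definition dom_int :: "nat \<Rightarrow> (real \<Rightarrow> real) \<Rightarrow> real \<Rightarrow> ('a::euclidean_space \<Rightarrow> real)
     \<Rightarrow> (real \<Rightarrow> real) \<Rightarrow> real" where
  "dom_int n lam a r f = sphere_int (\<lambda>\<theta>. integral {a..r \<theta>} (\<lambda>s. f s * (lam s) ^ n))"

end

(* Proof idea. Put N = n + 1, u = lambda o r and h = sqrt(lambda'^2 - 1), a function of lambda.
   Then the surface integral is the integral over the sphere of sqrt(G^2 + H^2) with G = u^n h(u) and
   H = u^(n-1) sqrt(u^2 + |grad u|^2), the Euclidean area density of the star body with radial
   function u; hence its square is at least (int G)^2 + (int H)^2.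
   The first term is bounded by int G by Jensen's inequality for a convex function of u^N,
   the second by (int H)^2 by the Euclidean isoperimetric inequality for star bodies.
   The latter follows from the Brunn-Minkowski inequality (Hadwiger-Ohmann) for the star body and a
   small ball, the Minkowski sum being contained in the star body of radial function
   u (1 + eps (|grad p| + eta)) with p the gauge.
   Equality forces G and H to be proportional; comparing with a maximum point of u, where grad u = 0
   and H = u^n, and using that h is strictly increasing, u is constant. *)
theory Submission
  imports Defs
begin

section \<open>The Brunn-Minkowski inequality\<close>

text \<open>The split into \<open>G\<close> and \<open>H\<close> is the identity lambda'^2 (u^2 +
  |grad r|^2) = (u h)^2 + u^2 + |grad u|^2, which comes from lambda'^2 = 1 + h^2 and grad u =
  lambda' grad r. For the first term, G' = N (F' + m / (2 h)) with F' = u^(n-1) h. So the domain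
  integral with factor m becomes int G - N int F(u), while the term with eta is N omega F(U), where
  U is the value of lambda on the slice with the same weighted volume. What remains is omega F(U)
  \<le> int F(u), which is Jensen because F is convex as a function of u^N: its derivative there is
  h(u) / (N u). Two degeneracies shape the proof. For m > 0, h vanishes at the inner boundary and 1
  / h is singular there, so the fundamental theorem of calculus is used on an open interval. For m =
  0, u itself may vanish, so the isoperimetric inequality is extended to non-negative radial
  functions, and in the equality case stray zeros of u are excluded by connectedness of the
  sphere.\<close>

lemma root_prod_add_le:
  fixes x y :: "'i \<Rightarrow> real"
  assumes S: "finite S" "S \<noteq> {}"
    and x: "\<And>i. i \<in> S \<Longrightarrow> 0 \<le> x i" and y: "\<And>i. i \<in> S \<Longrightarrow> 0 \<le> y i"
    and xy: "\<And>i. i \<in> S \<Longrightarrow> 0 < x i + y i"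
  shows "root (card S) (\<Prod>i\<in>S. x i) + root (card S) (\<Prod>i\<in>S. y i)
           \<le> root (card S) (\<Prod>i\<in>S. x i + y i)"
proof -
  have card: "0 < card S"
    using S card_gt_0_iff by blast
  have amgm: "root (card S) (\<Prod>i\<in>S. z i) \<le> (\<Sum>i\<in>S. z i / card S)"
    if "\<And>i. i \<in> S \<Longrightarrow> 0 \<le> z i" for z :: "'i \<Rightarrow> real"
  proof (cases "(\<Prod>i\<in>S. z i) = 0")
    case True
    then show ?thesis
      using card that by (auto intro!: sum_nonneg)
  next
    case False
    then have "0 < (\<Prod>i\<in>S. z i)"
      using that by (simp add: less_le prod_nonneg)
    then show ?thesis
      using arith_geom_mean[of S z] S that card by (simp add: root_powr_inverse inverse_eq_divide)
  qed
  let ?P = "\<Prod>i\<in>S. x i + y i"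
  have P: "0 < ?P"
    using xy by (simp add: prod_pos)
  have eq: "root (card S) (\<Prod>i\<in>S. z i / (x i + y i)) = root (card S) (\<Prod>i\<in>S. z i) / root (card S) ?P" for z
    by (simp add: prod_dividef real_root_divide card)
  \<comment> \<open>AM-GM is applied to the ratios x_i / (x_i + y_i) and to the ratios y_i / (x_i +
    y_i); the two arithmetic means add up to 1.\<close>
  have "root (card S) (\<Prod>i\<in>S. x i / (x i + y i)) + root (card S) (\<Prod>i\<in>S. y i / (x i + y i))
      \<le> (\<Sum>i\<in>S. x i / (x i + y i) / card S) + (\<Sum>i\<in>S. y i / (x i + y i) / card S)"
    by (intro add_mono amgm) (use x y xy in \<open>auto intro!: divide_nonneg_pos\<close>)
  also have "\<dots> = (\<Sum>i\<in>S. 1 / card S)"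
    unfolding sum.distrib[symmetric]
  proof (rule sum.cong)
    fix i assume "i \<in> S"
    then have "x i + y i \<noteq> 0"
      using xy by force
    then show "x i / (x i + y i) / card S + y i / (x i + y i) / card S = 1 / card S"
      by (metis add_divide_distrib divide_self)
  qed simp
  also have "\<dots> = 1"
    using card by simp
  finally have "(root (card S) (\<Prod>i\<in>S. x i) + root (card S) (\<Prod>i\<in>S. y i)) / root (card S) ?P \<le> 1"
    unfolding eq by (simp add: add_divide_distrib)
  moreover have "0 < root (card S) ?P"
    using P card by simp
  ultimately show ?thesis
    by (simp add: pos_divide_le_eq)
qed

lemma measure_box:
  fixes a b :: "'a::euclidean_space"
  assumes "box a b \<noteq> {}"
  shows "measure lebesgue (box a b) = (\<Prod>i\<in>Basis. (b - a) \<bullet> i)"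
proof -
  have "measure lebesgue (box a b) = measure lborel (box a b)"
    by (simp add: measure_completion)
  also have "\<dots> = (\<Prod>i\<in>Basis. (b - a) \<bullet> i)"
    using assms by (subst measure_lborel_box) (auto simp: box_ne_empty less_imp_le)
  finally show ?thesis .
qed

lemma open_set_plus:
  fixes A B :: "'a::real_normed_vector set"
  assumes "open B"
  shows "open (A + B)"
proof -
  have "A + B = (\<Union>a\<in>A. (+) a ` B)"
    by (auto simp: set_plus_def)
  then show ?thesis
    using assms by (auto intro!: open_translation)
qed

lemma bounded_set_plus:
  fixes A B :: "'a::real_normed_vector set"
  assumes "bounded A" "bounded B"
  shows "bounded (A + B)"
proof -
  have "A + B = (\<Union>x\<in>A. \<Union>y\<in>B. {x + y})"
    by (auto simp: set_plus_def)
  then show ?thesis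
    using bounded_sums[OF assms] by simp
qed

lemma lmeasurable_open_bounded:
  fixes S :: "'a::euclidean_space set"
  assumes "open S" "bounded S"
  shows "S \<in> lmeasurable"
  using assms by (simp add: lmeasurable_open)

text \<open>\<open>z\<close> is split coordinate by coordinate, both summands sitting at the same
  relative position t_i in their intervals.\<close>

lemma box_plus_box_subset:
  fixes a b c d :: "'a::euclidean_space"
  assumes "box a b \<noteq> {}" "box c d \<noteq> {}"
  shows "box (a + c) (b + d) \<subseteq> box a b + box c d"
proof
  fix z assume z: "z \<in> box (a + c) (b + d)"
  define t where "t i = (z \<bullet> i - a \<bullet> i - c \<bullet> i) / ((b - a) \<bullet> i + (d - c) \<bullet> i)" for i
  define x where "x = (\<Sum>i\<in>Basis. (a \<bullet> i + t i * ((b - a) \<bullet> i)) *\<^sub>R i)"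
  define y where "y = (\<Sum>i\<in>Basis. (c \<bullet> i + t i * ((d - c) \<bullet> i)) *\<^sub>R i)"
  have ba: "0 < (b - a) \<bullet> i" "0 < (d - c) \<bullet> i" if "i \<in> Basis" for i
    using assms that by (auto simp: box_ne_empty inner_diff_left)
  have t: "0 < t i" "t i < 1" if "i \<in> Basis" for i
    using z ba[OF that] that unfolding t_def
    by (auto simp: mem_box inner_add_left inner_diff_left divide_less_eq intro!: divide_pos_pos)
  have "z = x + y"
  proof (rule euclidean_eqI)
    fix i :: 'a assume i: "i \<in> Basis"
    have "t i * ((b - a) \<bullet> i) + t i * ((d - c) \<bullet> i) = t i * ((b - a) \<bullet> i + (d - c) \<bullet> i)"
      by (simp add: algebra_simps)
    also have "\<dots> = z \<bullet> i - a \<bullet> i - c \<bullet> i"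
      using ba[OF i] unfolding t_def by simp
    finally show "z \<bullet> i = (x + y) \<bullet> i"
      using i by (simp add: x_def y_def inner_add_left)
  qed
  moreover have "x \<in> box a b"
    unfolding mem_box
  proof
    fix i :: 'a assume i: "i \<in> Basis"
    have "t i * ((b - a) \<bullet> i) < 1 * ((b - a) \<bullet> i)" "0 < t i * ((b - a) \<bullet> i)"
      using t[OF i] ba[OF i] by (intro mult_strict_right_mono mult_pos_pos; simp)+
    moreover have "x \<bullet> i = a \<bullet> i + t i * ((b - a) \<bullet> i)"
      using i by (simp add: x_def)
    ultimately show "a \<bullet> i < x \<bullet> i \<and> x \<bullet> i < b \<bullet> i"
      using inner_diff_left[of b a i] by linarith
  qed
  moreover have "y \<in> box c d"
    unfolding mem_box
  proof
    fix i :: 'a assume i: "i \<in> Basis"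
    have "t i * ((d - c) \<bullet> i) < 1 * ((d - c) \<bullet> i)" "0 < t i * ((d - c) \<bullet> i)"
      using t[OF i] ba[OF i] by (intro mult_strict_right_mono mult_pos_pos; simp)+
    moreover have "y \<bullet> i = c \<bullet> i + t i * ((d - c) \<bullet> i)"
      using i by (simp add: y_def)
    ultimately show "c \<bullet> i < y \<bullet> i \<and> y \<bullet> i < d \<bullet> i"
      using inner_diff_left[of d c i] by linarith
  qed
  ultimately show "z \<in> box a b + box c d"
    by (simp add: set_plus_intro)
qed

text \<open>The power stands on the left, instead of a root on the right, because in this form both
  sides add up when the sets are cut in equal proportions. The sum contains a box whose edges are
  the sums of the edges, so the claim is \<open>root_prod_add_le\<close> for the edge
  lengths.\<close>

lemma brunn_minkowski_box:
  fixes a b c d :: "'a::euclidean_space"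
  assumes ne: "box a b \<noteq> {}" "box c d \<noteq> {}"
  shows "(root DIM('a) (measure lebesgue (box a b)) + root DIM('a) (measure lebesgue (box c d))) ^ DIM('a)
    \<le> measure lebesgue (box a b + box c d)"
proof -
  have ba: "0 < (b - a) \<bullet> i" "0 < (d - c) \<bullet> i" if "i \<in> Basis" for i
    using ne that by (auto simp: box_ne_empty inner_diff_left)
  have ne': "box (a + c) (b + d) \<noteq> {}"
    using ne by (auto simp: box_ne_empty inner_add_left add_strict_mono)
  have "root DIM('a) (measure lebesgue (box a b)) + root DIM('a) (measure lebesgue (box c d))
      \<le> root DIM('a) (measure lebesgue (box (a + c) (b + d)))"
  proof -
    have "root DIM('a) (\<Prod>i\<in>Basis. (b - a) \<bullet> i) + root DIM('a) (\<Prod>i\<in>Basis. (d - c) \<bullet> i)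
      \<le> root DIM('a) (\<Prod>i\<in>Basis. (b - a) \<bullet> i + (d - c) \<bullet> i)"
      by (rule root_prod_add_le) (use ba in \<open>auto intro: less_imp_le add_pos_pos\<close>)
    also have "(\<Prod>i\<in>Basis. (b - a) \<bullet> i + (d - c) \<bullet> i) = measure lebesgue (box (a + c) (b + d))"
      unfolding measure_box[OF ne'] by (intro prod.cong) (auto simp: inner_simps)
    finally show ?thesis
      by (simp only: measure_box[OF ne(1)] measure_box[OF ne(2)])
  qed
  then have "(root DIM('a) (measure lebesgue (box a b)) + root DIM('a) (measure lebesgue (box c d))) ^ DIM('a)
      \<le> root DIM('a) (measure lebesgue (box (a + c) (b + d))) ^ DIM('a)"
    by (intro power_mono add_nonneg_nonneg) auto
  also have "\<dots> = measure lebesgue (box (a + c) (b + d))"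
    by simp
  also have "\<dots> \<le> measure lebesgue (box a b + box c d)"
    by (intro measure_mono_fmeasurable box_plus_box_subset ne)
      (auto intro!: lmeasurable_open_bounded open_set_plus bounded_set_plus)
  finally show ?thesis .
qed

section \<open>Finite disjoint unions of open boxes\<close>

text \<open>\<open>k\<close> is an upper bound and not the exact number of boxes, so that a cut
  which discards some boxes needs no recount. Open boxes make all Minkowski sums open, hence
  measurable; non-empty ones ensure that the set meets both sides of a hyperplane between two of
  them.\<close>

definition elementary_open :: "nat \<Rightarrow> 'a::euclidean_space set \<Rightarrow> bool" where
  "elementary_open k A \<longleftrightarrow> (\<exists>P. finite P \<and> card P \<le> k \<and> pairwise disjnt P \<and>
     (\<forall>K\<in>P. K \<noteq> {} \<and> (\<exists>a b. K = box a b)) \<and> A = \<Union>P)"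

lemma elementary_open_imp_open: "elementary_open k A \<Longrightarrow> open A"
  unfolding elementary_open_def by (elim exE conjE) (force intro!: open_Union)

lemma elementary_open_imp_bounded: "elementary_open k A \<Longrightarrow> bounded A"
  unfolding elementary_open_def by (elim exE conjE) (force intro!: bounded_Union)

lemma box_Int_halfspace_less:
  fixes a b :: "'a::euclidean_space"
  assumes "i \<in> Basis"
  shows "box a b \<inter> {x. x \<bullet> i < c} = box a (b + (min (b \<bullet> i) c - b \<bullet> i) *\<^sub>R i)"
proof -
  have "(b + (min (b \<bullet> i) c - b \<bullet> i) *\<^sub>R i) \<bullet> j = (if j = i then min (b \<bullet> i) c else b \<bullet> j)"
    if "j \<in> Basis" for j
    using assms that by (auto simp: inner_simps inner_Basis)
  then have "x \<in> box a (b + (min (b \<bullet> i) c - b \<bullet> i) *\<^sub>R i) \<longleftrightarrow>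
     (\<forall>j\<in>Basis. a \<bullet> j < x \<bullet> j \<and> x \<bullet> j < (if j = i then min (b \<bullet> i) c else b \<bullet> j))" for x
    by (simp add: mem_box)
  moreover have "(\<forall>j\<in>Basis. a \<bullet> j < x \<bullet> j \<and> x \<bullet> j < (if j = i then min (b \<bullet> i) c else b \<bullet> j))
      \<longleftrightarrow> (\<forall>j\<in>Basis. a \<bullet> j < x \<bullet> j \<and> x \<bullet> j < b \<bullet> j) \<and> x \<bullet> i < c" for x
  proof
    assume L: "\<forall>j\<in>Basis. a \<bullet> j < x \<bullet> j \<and> x \<bullet> j < (if j = i then min (b \<bullet> i) c else b \<bullet> j)"
    have "a \<bullet> j < x \<bullet> j \<and> x \<bullet> j < b \<bullet> j" if "j \<in> Basis" for j
      using bspec[OF L that] by (auto split: if_splits)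
    moreover have "x \<bullet> i < c"
      using bspec[OF L assms] by simp
    ultimately show "(\<forall>j\<in>Basis. a \<bullet> j < x \<bullet> j \<and> x \<bullet> j < b \<bullet> j) \<and> x \<bullet> i < c"
      by simp
  qed simp
  ultimately show ?thesis
    by (simp add: mem_box set_eq_iff)
qed

lemma box_Int_halfspace_greater:
  fixes a b :: "'a::euclidean_space"
  assumes "i \<in> Basis"
  shows "box a b \<inter> {x. c < x \<bullet> i} = box (a + (max (a \<bullet> i) c - a \<bullet> i) *\<^sub>R i) b"
proof -
  have "(a + (max (a \<bullet> i) c - a \<bullet> i) *\<^sub>R i) \<bullet> j = (if j = i then max (a \<bullet> i) c else a \<bullet> j)"
    if "j \<in> Basis" for j
    using assms that by (auto simp: inner_simps inner_Basis)
  then have "x \<in> box (a + (max (a \<bullet> i) c - a \<bullet> i) *\<^sub>R i) b \<longleftrightarrow>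
     (\<forall>j\<in>Basis. (if j = i then max (a \<bullet> i) c else a \<bullet> j) < x \<bullet> j \<and> x \<bullet> j < b \<bullet> j)" for x
    by (simp add: mem_box)
  moreover have "(\<forall>j\<in>Basis. (if j = i then max (a \<bullet> i) c else a \<bullet> j) < x \<bullet> j \<and> x \<bullet> j < b \<bullet> j)
      \<longleftrightarrow> (\<forall>j\<in>Basis. a \<bullet> j < x \<bullet> j \<and> x \<bullet> j < b \<bullet> j) \<and> c < x \<bullet> i" for x
  proof
    assume L: "\<forall>j\<in>Basis. (if j = i then max (a \<bullet> i) c else a \<bullet> j) < x \<bullet> j \<and> x \<bullet> j < b \<bullet> j"
    have "a \<bullet> j < x \<bullet> j \<and> x \<bullet> j < b \<bullet> j" if "j \<in> Basis" for j
      using bspec[OF L that] by (auto split: if_splits)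
    moreover have "c < x \<bullet> i"
      using bspec[OF L assms] by simp
    ultimately show "(\<forall>j\<in>Basis. a \<bullet> j < x \<bullet> j \<and> x \<bullet> j < b \<bullet> j) \<and> c < x \<bullet> i"
      by simp
  qed simp
  ultimately show ?thesis
    by (simp add: mem_box set_eq_iff)
qed

text \<open>Only boxes that meet \<open>H\<close> are counted, which is what lets a cut lower the
  bound.\<close>

lemma Union_boxes_Int:
  assumes P: "finite P" "pairwise disjnt P" "\<And>K. K \<in> P \<Longrightarrow> K \<noteq> {} \<and> (\<exists>a b. K = box a b)"
    and H: "\<And>a b. \<exists>a' b'. box a b \<inter> H = box a' b'"
    and k: "card {K \<in> P. K \<inter> H \<noteq> {}} \<le> k"
  shows "elementary_open k (\<Union>P \<inter> H)"
  unfolding elementary_open_def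
proof (intro exI conjI)
  let ?P = "(\<lambda>K. K \<inter> H) ` {K \<in> P. K \<inter> H \<noteq> {}}"
  show "finite ?P"
    using P by simp
  show "card ?P \<le> k"
    using P k card_image_le[of "{K \<in> P. K \<inter> H \<noteq> {}}" "\<lambda>K. K \<inter> H"] by simp
  show "pairwise disjnt ?P"
    using P(2) unfolding pairwise_def disjnt_def by blast
  show "\<forall>K\<in>?P. K \<noteq> {} \<and> (\<exists>a b. K = box a b)"
  proof
    fix K' assume "K' \<in> ?P"
    then obtain K where K: "K \<in> P" "K' = K \<inter> H" "K \<inter> H \<noteq> {}"
      by blast
    then obtain a b where "K = box a b"
      using P(3) by blast
    then show "K' \<noteq> {} \<and> (\<exists>a b. K' = box a b)"
      using K H by simp
  qed
  show "\<Union>P \<inter> H = \<Union>?P"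
    by auto
qed

lemma elementary_open_Int:
  assumes "elementary_open k A" and H: "\<And>a b. \<exists>a' b'. box a b \<inter> H = box a' b'"
  shows "elementary_open k (A \<inter> H)"
proof -
  obtain P where P: "finite P" "card P \<le> k" "pairwise disjnt P"
    "\<And>K. K \<in> P \<Longrightarrow> K \<noteq> {} \<and> (\<exists>a b. K = box a b)" "A = \<Union>P"
    using assms(1) unfolding elementary_open_def by blast
  have "card {K \<in> P. K \<inter> H \<noteq> {}} \<le> k"
    using card_mono[of P "{K \<in> P. K \<inter> H \<noteq> {}}"] P(1,2) by simp
  then show ?thesis
    unfolding P(5) by (intro Union_boxes_Int P H)
qed

text \<open>Disjoint boxes have disjoint projections to some axis, and an endpoint of one projection
  gives the hyperplane. Which box lies below is left open, hence two cases.\<close>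

lemma disjnt_boxes_separated:
  fixes a b c d :: "'a::euclidean_space"
  assumes "disjnt (box a b) (box c d)" "box a b \<noteq> {}" "box c d \<noteq> {}"
  obtains i s where "i \<in> Basis" "box a b \<subseteq> {x. x \<bullet> i < s}" "box c d \<subseteq> {x. s < x \<bullet> i}"
  | i s where "i \<in> Basis" "box c d \<subseteq> {x. x \<bullet> i < s}" "box a b \<subseteq> {x. s < x \<bullet> i}"
proof -
  have "box a b \<inter> box c d = {}"
    using assms by (simp add: disjnt_def)
  then obtain i where i: "i \<in> Basis" "b \<bullet> i \<le> a \<bullet> i \<or> d \<bullet> i \<le> c \<bullet> i \<or> b \<bullet> i \<le> c \<bullet> i \<or> d \<bullet> i \<le> a \<bullet> i"
    unfolding disjoint_interval by blast
  moreover have "a \<bullet> i < b \<bullet> i" "c \<bullet> i < d \<bullet> i"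
    using assms i by (auto simp: box_ne_empty)
  ultimately have "b \<bullet> i \<le> c \<bullet> i \<or> d \<bullet> i \<le> a \<bullet> i"
    by linarith
  then show ?thesis
  proof
    assume "b \<bullet> i \<le> c \<bullet> i"
    then show ?thesis
      using i by (intro that(1)[of i "b \<bullet> i"]) (force simp: mem_box)+
  next
    assume "d \<bullet> i \<le> a \<bullet> i"
    then show ?thesis
      using i by (intro that(2)[of i "d \<bullet> i"]) (force simp: mem_box)+
  qed
qed

text \<open>A union that is not a single box contains two boxes, and a hyperplane between them
  leaves at least one whole box out of each half, so each half needs one box fewer.\<close>

lemma elementary_open_split:
  fixes A :: "'a::euclidean_space set"
  assumes "elementary_open (Suc k) A" "A \<noteq> {}" "\<nexists>a b. A = box a b"
  obtains i s where "i \<in> Basis" "A \<inter> {x. x \<bullet> i < s} \<noteq> {}" "A \<inter> {x. s < x \<bullet> i} \<noteq> {}"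
    "elementary_open k (A \<inter> {x. x \<bullet> i < s})" "elementary_open k (A \<inter> {x. s < x \<bullet> i})"
proof -
  obtain P where P: "finite P" "card P \<le> Suc k" "pairwise disjnt P"
    "\<And>K. K \<in> P \<Longrightarrow> K \<noteq> {} \<and> (\<exists>a b. K = box a b)" "A = \<Union>P"
    using assms(1) unfolding elementary_open_def by blast
  have "P \<noteq> {}"
    using P(5) assms(2) by auto
  then obtain K where K: "K \<in> P"
    by blast
  moreover have "P \<noteq> {K}"
    using P(4,5) assms(3) K by auto
  ultimately obtain L where L: "L \<in> P" "L \<noteq> K"
    by blast
  obtain i s K' L' where i: "i \<in> Basis" and K': "K' \<in> P" "K' \<subseteq> {x. x \<bullet> i < s}"
    and L': "L' \<in> P" "L' \<subseteq> {x. s < x \<bullet> i}"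
  proof -
    obtain a b c d where "K = box a b" "L = box c d"
      using P(4) K L by metis
    moreover have "disjnt K L"
      using P(3) K L by (auto simp: pairwise_def)
    ultimately show ?thesis
      using disjnt_boxes_separated[of a b c d] P(4) K L that by metis
  qed
  have less: "card {K \<in> P. K \<inter> H \<noteq> {}} \<le> k" if "M \<in> P" "M \<inter> H = {}" for M and H :: "'a set"
  proof -
    have "card {K \<in> P. K \<inter> H \<noteq> {}} < card P"
      using that P(1) by (intro psubset_card_mono) auto
    then show ?thesis
      using P(2) by simp
  qed
  have "elementary_open k (A \<inter> {x. x \<bullet> i < s})"
    unfolding P(5)
  proof (rule Union_boxes_Int[OF P(1,3,4)])
    show "\<exists>a' b'. box a b \<inter> {x. x \<bullet> i < s} = box a' b'" for a b
      using box_Int_halfspace_less[OF i] by blast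
    show "card {K \<in> P. K \<inter> {x. x \<bullet> i < s} \<noteq> {}} \<le> k"
      using L' by (intro less[of L']) auto
  qed
  moreover have "elementary_open k (A \<inter> {x. s < x \<bullet> i})"
    unfolding P(5)
  proof (rule Union_boxes_Int[OF P(1,3,4)])
    show "\<exists>a' b'. box a b \<inter> {x. s < x \<bullet> i} = box a' b'" for a b
      using box_Int_halfspace_greater[OF i] by blast
    show "card {K \<in> P. K \<inter> {x. s < x \<bullet> i} \<noteq> {}} \<le> k"
      using K' by (intro less[of K']) auto
  qed
  moreover have "A \<inter> {x. x \<bullet> i < s} \<noteq> {}"
  proof -
    obtain x where "x \<in> K'"
      using P(4)[OF K'(1)] by (auto simp only: ex_in_conv[symmetric])
    then show ?thesis
      using K' P(5) by (simp only: ex_in_conv[symmetric]) (rule exI[of _ x], auto)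
  qed
  moreover have "A \<inter> {x. s < x \<bullet> i} \<noteq> {}"
  proof -
    obtain x where "x \<in> L'"
      using P(4)[OF L'(1)] by (auto simp only: ex_in_conv[symmetric])
    then show ?thesis
      using L' P(5) by (simp only: ex_in_conv[symmetric]) (rule exI[of _ x], auto)
  qed
  ultimately show ?thesis
    by (intro that[OF i])
qed

text \<open>Cutting at \<open>c\<close> replaces the upper end b_i by min(b_i, c). With every factor
  truncated at 0, the product formula stays valid where the half-space misses the box, and it is
  visibly continuous.\<close>

lemma continuous_measure_box_halfspace:
  fixes a b :: "'a::euclidean_space"
  assumes i: "i \<in> Basis" and ne: "box a b \<noteq> {}"
  shows "continuous_on UNIV (\<lambda>c. measure lebesgue (box a b \<inter> {x. x \<bullet> i < c}))"
proof -
  have ba: "a \<bullet> j < b \<bullet> j" if "j \<in> Basis" for j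
    using ne that by (auto simp: box_ne_empty)
  have "measure lebesgue (box a b \<inter> {x. x \<bullet> i < c})
      = (\<Prod>j\<in>Basis. max 0 ((b + (min (b \<bullet> i) c - b \<bullet> i) *\<^sub>R i - a) \<bullet> j))" (is "?l = ?r") for c
  proof (cases "a \<bullet> i < c")
    case True
    then have ne': "box a (b + (min (b \<bullet> i) c - b \<bullet> i) *\<^sub>R i) \<noteq> {}"
      using ba i by (auto simp: box_ne_empty inner_simps inner_Basis)
    have "?l = (\<Prod>j\<in>Basis. (b + (min (b \<bullet> i) c - b \<bullet> i) *\<^sub>R i - a) \<bullet> j)"
      by (simp only: box_Int_halfspace_less[OF i] measure_box[OF ne'])
    also have "\<dots> = ?r"
      using ne' by (intro prod.cong refl) (auto simp: box_ne_empty inner_simps max_def less_imp_le)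
    finally show ?thesis .
  next
    case False
    then have "box a b \<inter> {x. x \<bullet> i < c} = {}"
      using i by (auto simp: mem_box) (meson less_trans not_less)
    moreover have "?r = 0"
      by (rule prod_zero[OF finite_Basis]) (rule bexI[OF _ i], use False i ba[OF i] in \<open>simp add: inner_simps\<close>)
    ultimately show ?thesis
      by simp
  qed
  then show ?thesis
    by (simp only: inner_simps) (intro continuous_intros)
qed

text \<open>Intermediate value theorem: the cut-off volume, a finite sum over the boxes, grows
  continuously from 0 to the whole volume.\<close>

lemma measure_elementary_open_halfspace:
  fixes A :: "'a::euclidean_space set"
  assumes A: "elementary_open k A" and i: "i \<in> Basis" and t: "0 < t" "t < 1"
  obtains c where "measure lebesgue (A \<inter> {x. x \<bullet> i < c}) = t * measure lebesgue A"
proof -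
  obtain P where P: "finite P" "pairwise disjnt P"
    "\<And>K. K \<in> P \<Longrightarrow> K \<noteq> {} \<and> (\<exists>a b. K = box a b)" "A = \<Union>P"
    using A unfolding elementary_open_def by blast
  define g where "g c = measure lebesgue (A \<inter> {x. x \<bullet> i < c})" for c
  have meas: "K \<inter> {x. x \<bullet> i < c} \<in> lmeasurable" if KP: "K \<in> P" for K c
  proof -
    obtain a b where "K = box a b" using P(3)[OF KP] by blast
    then show ?thesis
      by (simp add: box_Int_halfspace_less[OF i])
  qed
  have "g c = (\<Sum>K\<in>P. measure lebesgue (K \<inter> {x. x \<bullet> i < c}))" for c
  proof -
    have eq: "A \<inter> {x. x \<bullet> i < c} = (\<Union>K\<in>P. K \<inter> {x. x \<bullet> i < c})"
      using P(4) by blast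
    have "disjoint_family_on (\<lambda>K. K \<inter> {x. x \<bullet> i < c}) P"
      using P(2) unfolding disjoint_family_on_def pairwise_def disjnt_def by blast
    then show ?thesis
      unfolding g_def eq using fmeasurableD[OF meas] fmeasurableD2[OF meas]
      by (intro measure_finite_Union P(1)) (auto simp del: emeasure_completion)
  qed
  moreover have "continuous_on UNIV (\<lambda>c. \<Sum>K\<in>P. measure lebesgue (K \<inter> {x. x \<bullet> i < c}))"
  proof (intro continuous_on_sum)
    fix K assume "K \<in> P"
    then obtain a b where "K = box a b" "K \<noteq> {}" using P(3) by metis
    then show "continuous_on UNIV (\<lambda>c. measure lebesgue (K \<inter> {x. x \<bullet> i < c}))"
      using continuous_measure_box_halfspace[OF i] by blast
  qed
  ultimately have cont: "continuous_on UNIV g"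
    by presburger
  obtain B where B: "\<And>x. x \<in> A \<Longrightarrow> norm x < B"
    using elementary_open_imp_bounded[OF A] bounded_pos_less by metis
  have B': "\<bar>x \<bullet> i\<bar> < B" if "x \<in> A" for x
    using Basis_le_norm[OF i, of x] B[OF that] by linarith
  have "A \<inter> {x. x \<bullet> i < - \<bar>B\<bar>} = {}" "A \<inter> {x. x \<bullet> i < \<bar>B\<bar>} = A"
    using B' by fastforce+
  then have "g (- \<bar>B\<bar>) = 0" "g \<bar>B\<bar> = measure lebesgue A"
    by (simp_all add: g_def)
  moreover have "0 \<le> t * measure lebesgue A" "t * measure lebesgue A \<le> measure lebesgue A"
    using t by (auto simp: mult_left_le_one_le)
  moreover have "continuous_on {- \<bar>B\<bar>..\<bar>B\<bar>} g"
    using cont continuous_on_subset by blast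
  ultimately obtain c where "g c = t * measure lebesgue A"
    using IVT'[of g "- \<bar>B\<bar>" "t * measure lebesgue A" "\<bar>B\<bar>"] by auto
  then show ?thesis
    unfolding g_def by (rule that)
qed

lemma measure_open_pos:
  fixes S :: "'a::euclidean_space set"
  assumes "open S" "bounded S" "S \<noteq> {}"
  shows "0 < measure lebesgue S"
  using assms open_not_negligible[of S] lmeasurable_open_bounded[of S] negligible_iff_measure[of S]
  by (simp add: zero_less_measure_iff)

lemma measure_Un_disjnt:
  assumes "S \<in> fmeasurable M" "T \<in> fmeasurable M" "disjnt S T"
  shows "measure M (S \<union> T) = measure M S + measure M T"
  using assms by (intro measure_Union) (auto simp: disjnt_def dest: fmeasurableD2)

lemma measure_open_split:
  fixes S :: "'a::euclidean_space set"
  assumes S: "open S" "bounded S" and i: "i \<in> Basis"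
  shows "measure lebesgue S = measure lebesgue (S \<inter> {x. x \<bullet> i < c}) + measure lebesgue (S \<inter> {x. c < x \<bullet> i})"
proof -
  have op: "open {x::'a. x \<bullet> i < c}" "open {x::'a. c < x \<bullet> i}"
    by (rule open_halfspace_component_lt open_halfspace_component_gt)+
  then have meas: "S \<inter> {x. x \<bullet> i < c} \<in> lmeasurable" "S \<inter> {x. c < x \<bullet> i} \<in> lmeasurable"
    using S by (auto intro!: lmeasurable_open_bounded open_Int bounded_Int)
  have "i \<noteq> 0"
    using i by auto
  then have "negligible {x. i \<bullet> x = c}"
    by (rule negligible_hyperplane[OF disjI1])
  then have "negligible (S \<inter> {x. i \<bullet> x = c})"
    by (rule negligible_subset) simp
  then have "measure lebesgue S = measure lebesgue (S \<inter> {x. x \<bullet> i < c} \<union> S \<inter> {x. c < x \<bullet> i})"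
    by (intro measure_negligible_symdiff[symmetric] lmeasurable_open_bounded S)
      (erule negligible_subset, auto simp: inner_commute)
  also have "\<dots> = measure lebesgue (S \<inter> {x. x \<bullet> i < c}) + measure lebesgue (S \<inter> {x. c < x \<bullet> i})"
    by (rule measure_Un_disjnt[OF meas]) (auto simp: disjnt_def)
  finally show ?thesis .
qed

text \<open>Hadwiger and Ohmann: cut \<open>A\<close> by a hyperplane between two of its boxes, and \<open>B\<close> by a parallel
  one in the same proportion; the two halves of \<open>A + B\<close> are then separated.\<close>
lemma brunn_minkowski_cut:
  fixes A B :: "'a::euclidean_space set"
  defines "bm \<equiv> \<lambda>A B. (root DIM('a) (measure lebesgue A) + root DIM('a) (measure lebesgue B)) ^ DIM('a)
      \<le> measure lebesgue (A + B)"
  assumes A: "open A" "bounded A" and B: "elementary_open l B" "B \<noteq> {}" and i: "i \<in> Basis"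
    and ne: "A \<inter> {x. x \<bullet> i < s} \<noteq> {}" "A \<inter> {x. s < x \<bullet> i} \<noteq> {}"
    and bm1: "\<And>B'. elementary_open l B' \<Longrightarrow> B' \<noteq> {} \<Longrightarrow> bm (A \<inter> {x. x \<bullet> i < s}) B'"
    and bm2: "\<And>B'. elementary_open l B' \<Longrightarrow> B' \<noteq> {} \<Longrightarrow> bm (A \<inter> {x. s < x \<bullet> i}) B'"
  shows "bm A B"
proof -
  have op: "open {x::'a. x \<bullet> i < c}" "open {x::'a. c < x \<bullet> i}" for c
    by (rule open_halfspace_component_lt open_halfspace_component_gt)+
  note Bo = elementary_open_imp_open[OF B(1)] and Bb = elementary_open_imp_bounded[OF B(1)]
  let ?A1 = "A \<inter> {x. x \<bullet> i < s}" and ?A2 = "A \<inter> {x. s < x \<bullet> i}"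
  have A1: "0 < measure lebesgue ?A1" and A2: "0 < measure lebesgue ?A2"
    by (rule measure_open_pos[OF open_Int[OF A(1) op(1)] bounded_Int[OF disjI1[OF A(2)]] ne(1)],
        rule measure_open_pos[OF open_Int[OF A(1) op(2)] bounded_Int[OF disjI1[OF A(2)]] ne(2)])
  note A12 = measure_open_split[OF A i, of s]
  define t where "t = measure lebesgue ?A1 / measure lebesgue A"
  have t: "0 < t" "t < 1"
    using A1 A2 A12 unfolding t_def by auto
  obtain c where c: "measure lebesgue (B \<inter> {x. x \<bullet> i < c}) = t * measure lebesgue B"
    using measure_elementary_open_halfspace[OF B(1) i t] .
  let ?B1 = "B \<inter> {x. x \<bullet> i < c}" and ?B2 = "B \<inter> {x. c < x \<bullet> i}"
  have c2: "measure lebesgue ?B2 = (1 - t) * measure lebesgue B"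
    using measure_open_split[OF Bo Bb i, of c] c by (simp add: algebra_simps)
  have Bpos: "0 < measure lebesgue B"
    by (rule measure_open_pos[OF Bo Bb B(2)])
  have Bne: "?B1 \<noteq> {}" "?B2 \<noteq> {}"
    using c c2 t Bpos by (metis measure_empty mult_eq_0_iff less_irrefl, metis measure_empty mult_eq_0_iff less_irrefl diff_gt_0_iff_gt)
  have el: "elementary_open l ?B1" "elementary_open l ?B2"
    by (rule elementary_open_Int[OF B(1)], use box_Int_halfspace_less[OF i] in blast,
        rule elementary_open_Int[OF B(1)], use box_Int_halfspace_greater[OF i] in blast)
  have a1: "measure lebesgue ?A1 = t * measure lebesgue A" "measure lebesgue ?A2 = (1 - t) * measure lebesgue A"
    using A1 A2 A12 by (auto simp: t_def field_simps)
  let ?r = "\<lambda>S. root DIM('a) (measure lebesgue S)"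
  \<comment> \<open>The left side is homogeneous of degree 1 in the two volumes, so cutting both
    sets in the proportion t : 1 - t splits it exactly.\<close>
  have pow: "(root DIM('a) (u * x) + root DIM('a) (u * y)) ^ DIM('a) = u * (root DIM('a) x + root DIM('a) y) ^ DIM('a)"
    if "0 \<le> u" for u x y :: real
  proof -
    have "root DIM('a) (u * x) + root DIM('a) (u * y) = root DIM('a) u * (root DIM('a) x + root DIM('a) y)"
      by (simp add: real_root_mult distrib_left)
    then show ?thesis
      using that by (simp add: power_mult_distrib)
  qed
  have meas: "open (?A1 + ?B1)" "open (?A2 + ?B2)" "bounded (?A1 + ?B1)" "bounded (?A2 + ?B2)"
    using A Bo Bb op by (auto intro!: open_set_plus bounded_set_plus open_Int bounded_Int)
  have "(?r A + ?r B) ^ DIM('a) = t * (?r A + ?r B) ^ DIM('a) + (1 - t) * (?r A + ?r B) ^ DIM('a)"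
    by (simp add: algebra_simps)
  also have "\<dots> = (?r ?A1 + ?r ?B1) ^ DIM('a) + (?r ?A2 + ?r ?B2) ^ DIM('a)"
    unfolding a1 c c2 using t by (simp add: pow)
  also have "\<dots> \<le> measure lebesgue (?A1 + ?B1) + measure lebesgue (?A2 + ?B2)"
    using bm1[OF el(1) Bne(1)] bm2[OF el(2) Bne(2)] unfolding bm_def by simp
  also have "\<dots> = measure lebesgue ((?A1 + ?B1) \<union> (?A2 + ?B2))"
  proof (rule measure_Un_disjnt[symmetric])
    have "x \<bullet> i < s + c" if "x \<in> ?A1 + ?B1" for x
      using that by (auto elim!: set_plus_elim simp: inner_add_left)
    moreover have "s + c < x \<bullet> i" if "x \<in> ?A2 + ?B2" for x
      using that by (auto elim!: set_plus_elim simp: inner_add_left)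
    ultimately show "disjnt (?A1 + ?B1) (?A2 + ?B2)"
      unfolding disjnt_iff by (metis less_asym)
  qed (use meas in \<open>auto intro!: lmeasurable_open_bounded\<close>)
  also have "\<dots> \<le> measure lebesgue (A + B)"
  proof (rule measure_mono_fmeasurable)
    show "(?A1 + ?B1) \<union> (?A2 + ?B2) \<subseteq> A + B"
      by (intro Un_least set_plus_mono2) auto
    show "?A1 + ?B1 \<union> (?A2 + ?B2) \<in> sets lebesgue"
      using meas by (auto intro!: fmeasurableD[OF lmeasurable_open_bounded])
    show "A + B \<in> lmeasurable"
      using A Bo Bb by (auto intro!: lmeasurable_open_bounded open_set_plus bounded_set_plus)
  qed
  finally show ?thesis
    unfolding bm_def .
qed

text \<open>Induction on the total number of boxes: cutting a set that is not a box lowers its own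
  bound by one, while the halves of the other set keep theirs. Two single boxes are the base
  case.\<close>

lemma brunn_minkowski_elementary:
  fixes A B :: "'a::euclidean_space set"
  assumes "elementary_open k A" "elementary_open l B" "A \<noteq> {}" "B \<noteq> {}"
  shows "(root DIM('a) (measure lebesgue A) + root DIM('a) (measure lebesgue B)) ^ DIM('a)
      \<le> measure lebesgue (A + B)"
  using assms
proof (induction "k + l" arbitrary: k l A B rule: less_induct)
  case less
  have nz: "\<exists>j. k = Suc j" if "elementary_open k S" "S \<noteq> {}" for k and S :: "'a set"
    using that by (cases k) (auto simp: elementary_open_def)
  show ?case
  proof (cases "\<exists>a b. A = box a b")
    case False
    obtain k' where k': "k = Suc k'"
      using nz less.prems by blast
    obtain i s where i: "i \<in> Basis" and sp: "A \<inter> {x. x \<bullet> i < s} \<noteq> {}" "A \<inter> {x. s < x \<bullet> i} \<noteq> {}"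
      "elementary_open k' (A \<inter> {x. x \<bullet> i < s})" "elementary_open k' (A \<inter> {x. s < x \<bullet> i})"
      using elementary_open_split[of k' A] less.prems(1,3) False unfolding k' by blast
    show ?thesis
      by (rule brunn_minkowski_cut[OF elementary_open_imp_open[OF less.prems(1)]
            elementary_open_imp_bounded[OF less.prems(1)] less.prems(2,4) i sp(1,2)])
        (use sp less.hyps[of k' l] k' in auto)
  next
    case True
    show ?thesis
    proof (cases "\<exists>a b. B = box a b")
      case False
      obtain l' where l': "l = Suc l'"
        using nz less.prems by blast
      obtain i s where i: "i \<in> Basis" and sp: "B \<inter> {x. x \<bullet> i < s} \<noteq> {}" "B \<inter> {x. s < x \<bullet> i} \<noteq> {}"
        "elementary_open l' (B \<inter> {x. x \<bullet> i < s})" "elementary_open l' (B \<inter> {x. s < x \<bullet> i})"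
        using elementary_open_split[of l' B] less.prems(2,4) False unfolding l' by blast
      \<comment> \<open>Here \<open>A\<close> is a box and \<open>B\<close> is cut, so the roles are
        exchanged; the sum is commutative.\<close>
      have "(root DIM('a) (measure lebesgue B) + root DIM('a) (measure lebesgue A)) ^ DIM('a)
          \<le> measure lebesgue (B + A)"
        by (rule brunn_minkowski_cut[OF elementary_open_imp_open[OF less.prems(2)]
              elementary_open_imp_bounded[OF less.prems(2)] less.prems(1,3) i sp(1,2)])
          (use sp less.hyps[of l' k] l' in auto)
      then show ?thesis
        by (simp add: add.commute)
    qed (use True less.prems brunn_minkowski_box in blast)
  qed
qed

section \<open>From unions of boxes to bounded open sets\<close>

text \<open>A compact \<open>T\<close> inside \<open>U\<close> carries almost all the volume. It is
  covered by finitely many boxes whose closures lie in \<open>U\<close>; when their union is divided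
  into non-overlapping boxes, the interiors miss only a null set of faces.\<close>

lemma elementary_open_inner_approx:
  fixes U :: "'a::euclidean_space set"
  assumes U: "open U" "bounded U" and e: "0 < e"
  obtains k A where "elementary_open k A" "A \<subseteq> U" "measure lebesgue U - e < measure lebesgue A"
proof -
  have Um: "U \<in> lmeasurable"
    using U by (rule lmeasurable_open_bounded)
  obtain T where T: "closed T" "T \<subseteq> U" "U - T \<in> lmeasurable" "emeasure lebesgue (U - T) < ennreal e"
    using sets_lebesgue_inner_closed[OF fmeasurableD[OF Um] e] by metis
  have Tc: "compact T"
    using T U bounded_subset compact_eq_bounded_closed by blast
  have "measure lebesgue (U - T) < e"
    using T(3,4) e by (simp add: emeasure_eq_measure2 ennreal_less_iff del: emeasure_completion)
  moreover have "measure lebesgue (U - T) = measure lebesgue U - measure lebesgue T"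
    using measurable_measure_Diff[OF Um fmeasurableD[OF lmeasurable_compact[OF Tc]] T(2)] .
  ultimately have TU: "measure lebesgue U - e < measure lebesgue T"
    by linarith
  define C where "C = {(a, b). cbox a b \<subseteq> U}"
  have "T \<subseteq> (\<Union>ab\<in>C. box (fst ab) (snd ab))"
  proof
    fix x assume "x \<in> T"
    then have "x \<in> U" using T(2) by blast
    then obtain a b where "x \<in> box a b" "cbox a b \<subseteq> U"
      using U(1) open_contains_cbox by metis
    then show "x \<in> (\<Union>ab\<in>C. box (fst ab) (snd ab))"
      unfolding C_def by (auto intro!: bexI[of _ "(a, b)"])
  qed
  then obtain C' where C': "C' \<subseteq> C" "finite C'" "T \<subseteq> (\<Union>ab\<in>C'. box (fst ab) (snd ab))"
    by (rule compactE_image[OF Tc, rotated]) auto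
  define F where "F = (\<lambda>ab. cbox (fst ab) (snd ab)) ` C'"
  have "finite F"
    using C'(2) unfolding F_def by simp
  have TF: "T \<subseteq> \<Union>F"
    using C'(3) box_subset_cbox unfolding F_def by fastforce
  have FU: "\<Union>F \<subseteq> U"
    using C'(1) unfolding F_def C_def by fastforce
  obtain p where p: "p division_of \<Union>F"
    using elementary_unions_intervals[OF \<open>finite F\<close>] unfolding F_def by blast
  define P where "P = interior ` p - {{}}"
  have pb: "\<exists>a b. K = cbox a b" if "K \<in> p" for K
    using division_ofD(4)[OF p that] .
  have "elementary_open (card P) (\<Union>P)"
    unfolding elementary_open_def
  proof (intro exI[of _ P] conjI ballI)
    show "finite P"
      unfolding P_def using division_ofD(1)[OF p] by simp
    show "pairwise disjnt P"
      unfolding P_def pairwise_def disjnt_def using division_ofD(5)[OF p] by (auto; metis disjoint_iff)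
    fix K assume "K \<in> P"
    then show "K \<noteq> {}" "\<exists>a b. K = box a b"
      using pb unfolding P_def by (auto simp: interior_cbox) (metis interior_cbox)
  qed simp_all
  moreover have "\<Union>P \<subseteq> U"
  proof -
    have "\<Union>P \<subseteq> \<Union>p"
      using interior_subset unfolding P_def by blast
    then show ?thesis
      using FU division_ofD(6)[OF p] by simp
  qed
  moreover have "measure lebesgue T \<le> measure lebesgue (\<Union>P)"
  proof -
    let ?Z = "\<Union>K\<in>p. K - interior K"
    have "negligible (K - interior K)" if K: "K \<in> p" for K
    proof -
      obtain a b where "K = cbox a b"
        using pb[OF K] by blast
      then show ?thesis
        by (simp add: interior_cbox negligible_frontier_interval)
    qed
    then have Z: "negligible ?Z"
      using division_ofD(1)[OF p] by (intro negligible_Union) auto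
    have Pm: "\<Union>P \<in> lmeasurable"
      unfolding P_def using bounded_subset[OF U(2) \<open>\<Union>P \<subseteq> U\<close>] P_def
      by (intro lmeasurable_open_bounded open_Union) auto
    have PZ: "\<Union>P \<union> ?Z \<in> lmeasurable"
      using Z by (intro fmeasurable.Un Pm) (simp only: negligible_iff_measure)
    have "T \<subseteq> \<Union>P \<union> ?Z"
    proof
      fix x assume "x \<in> T"
      then obtain K where K: "K \<in> p" "x \<in> K"
        using TF unfolding division_ofD(6)[OF p, symmetric] by auto
      show "x \<in> \<Union>P \<union> ?Z"
      proof (cases "x \<in> interior K")
        case True
        then have "interior K \<in> P"
          using K(1) unfolding P_def by auto
        then show ?thesis
          using True by auto
      qed (use K in auto)
    qed
    then have "measure lebesgue T \<le> measure lebesgue (\<Union>P \<union> ?Z)"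
      by (rule measure_mono_fmeasurable[OF _ fmeasurableD[OF lmeasurable_compact[OF Tc]] PZ])
    also have "\<dots> = measure lebesgue (\<Union>P)"
      by (rule measure_negligible_symdiff[OF Pm]) (rule negligible_subset[OF Z], blast)
    finally show ?thesis .
  qed
  ultimately show ?thesis
    using that TU by (meson less_le_trans)
qed

text \<open>Homogeneity again: with inner approximations of volume at least \<open>s\<close> times
  the original, the whole left side loses only the factor \<open>s\<close>, and \<open>s\<close> is
  any number between 0 and 1.\<close>

theorem brunn_minkowski_open:
  fixes U V :: "'a::euclidean_space set"
  assumes U: "open U" "bounded U" "U \<noteq> {}" and V: "open V" "bounded V" "V \<noteq> {}"
  shows "(root DIM('a) (measure lebesgue U) + root DIM('a) (measure lebesgue V)) ^ DIM('a)
      \<le> measure lebesgue (U + V)"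
proof (rule field_le_mult_one_interval)
  fix s :: real assume s: "0 < s" "s < 1"
  have appr: "\<exists>k A. elementary_open k A \<and> A \<subseteq> W \<and> A \<noteq> {} \<and> s * measure lebesgue W \<le> measure lebesgue A"
    if W: "open W" "bounded W" "W \<noteq> {}" for W :: "'a set"
  proof -
    have pos: "0 < measure lebesgue W"
      using measure_open_pos[OF W] .
    then have "0 < (1 - s) * measure lebesgue W"
      using s by simp
    then obtain k A where A: "elementary_open k A" "A \<subseteq> W"
      "measure lebesgue W - (1 - s) * measure lebesgue W < measure lebesgue A"
      using elementary_open_inner_approx[OF W(1,2)] by metis
    then have less: "s * measure lebesgue W < measure lebesgue A"
      by (simp add: algebra_simps)
    moreover have "0 < s * measure lebesgue W"
      using s pos by simp
    ultimately have "A \<noteq> {}"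
      by (metis less_asym measure_empty)
    then show ?thesis
      using A less by (meson less_imp_le)
  qed
  obtain k A where A: "elementary_open k A" "A \<subseteq> U" "A \<noteq> {}" "s * measure lebesgue U \<le> measure lebesgue A"
    using appr[OF U] by blast
  obtain l B where B: "elementary_open l B" "B \<subseteq> V" "B \<noteq> {}" "s * measure lebesgue V \<le> measure lebesgue B"
    using appr[OF V] by blast
  have "s * (root DIM('a) (measure lebesgue U) + root DIM('a) (measure lebesgue V)) ^ DIM('a)
     = (root DIM('a) s * (root DIM('a) (measure lebesgue U) + root DIM('a) (measure lebesgue V))) ^ DIM('a)"
    using s by (simp add: power_mult_distrib)
  also have "\<dots> = (root DIM('a) (s * measure lebesgue U) + root DIM('a) (s * measure lebesgue V)) ^ DIM('a)"
    by (simp add: real_root_mult distrib_left)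
  also have "\<dots> \<le> (root DIM('a) (measure lebesgue A) + root DIM('a) (measure lebesgue B)) ^ DIM('a)"
    using A(4) B(4) s by (intro power_mono add_mono add_nonneg_nonneg) auto
  also have "\<dots> \<le> measure lebesgue (A + B)"
    by (rule brunn_minkowski_elementary[OF A(1) B(1) A(3) B(3)])
  also have "\<dots> \<le> measure lebesgue (U + V)"
  proof (rule measure_mono_fmeasurable)
    show "A + B \<in> sets lebesgue"
      using elementary_open_imp_open[OF B(1)] by (simp add: lebesgue_openin open_set_plus)
    show "U + V \<in> lmeasurable"
      by (intro lmeasurable_open_bounded open_set_plus bounded_set_plus U V)
  qed (intro set_plus_mono2 A B)
  finally show "s * (root DIM('a) (measure lebesgue U) + root DIM('a) (measure lebesgue V)) ^ DIM('a)
    \<le> measure lebesgue (U + V)" .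
qed

section \<open>Integration over the sphere\<close>

lemma continuous_on_sphere_sgn:
  fixes f :: "'a::euclidean_space \<Rightarrow> 'b::topological_space"
  assumes "continuous_on (sphere 0 1) f"
  shows "continuous_on (- {0}) (\<lambda>x. f (sgn x))"
proof (rule continuous_on_compose2[OF assms])
  show "continuous_on (- {0}) (sgn :: 'a \<Rightarrow> 'a)"
    by (intro continuous_on_sgn continuous_on_id) auto
qed (auto simp: norm_sgn split: if_splits)

text \<open>Deleting the origin changes no integral and leaves a domain on which \<open>f\<close>
  composed with \<open>sgn\<close> is continuous for continuous \<open>f\<close>.\<close>

lemma sphere_int_sgn:
  "sphere_int f = real DIM('a) * integral (ball 0 1 - {0}) (\<lambda>x::'a::euclidean_space. f (sgn x))"
proof -
  have "integral (ball 0 1) (\<lambda>x. f (sgn x)) = integral (ball 0 1 - {0}) (\<lambda>x. f (sgn x))"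
    by (rule integral_spike_set; rule negligible_subset[of "{0}"]) auto
  then show ?thesis
    by (simp add: sphere_int_def sgn_div_norm)
qed

lemma lmeasurable_punctured_ball: "ball (0::'a::euclidean_space) 1 - {0} \<in> lmeasurable"
  by (intro lmeasurable_open_bounded open_Diff bounded_subset[OF bounded_ball]) auto

lemma absolutely_integrable_sphere_sgn:
  fixes f :: "'a::euclidean_space \<Rightarrow> real"
  assumes f: "continuous_on (sphere 0 1) f"
  shows "(\<lambda>x. f (sgn x)) absolutely_integrable_on ball 0 1 - {0}"
proof -
  have "bounded (f ` sphere 0 1)"
    using f by (intro compact_imp_bounded compact_continuous_image) auto
  then obtain C where C: "\<And>\<theta>. \<theta> \<in> sphere 0 1 \<Longrightarrow> norm (f \<theta>) \<le> C"
    unfolding bounded_iff by blast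
  show ?thesis
  proof (rule measurable_bounded_by_integrable_imp_absolutely_integrable)
    have "continuous_on (ball 0 1 - {0}) (\<lambda>x::'a. f (sgn x))"
      by (rule continuous_on_subset[OF continuous_on_sphere_sgn[OF f]]) auto
    then show "(\<lambda>x. f (sgn x)) \<in> borel_measurable (lebesgue_on (ball 0 1 - {0}))"
      by (rule continuous_imp_measurable_on_sets_lebesgue) auto
    show "(\<lambda>_::'a. C) integrable_on ball 0 1 - {0}"
      by (rule integrable_on_const[OF lmeasurable_punctured_ball])
    show "norm (f (sgn x)) \<le> C" if "x \<in> ball 0 1 - {0}" for x
      using that by (intro C) (auto simp: norm_sgn)
  qed auto
qed

lemma integrable_sphere_sgn:
  fixes f :: "'a::euclidean_space \<Rightarrow> real"
  assumes "continuous_on (sphere 0 1) f"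
  shows "(\<lambda>x. f (sgn x)) integrable_on ball 0 1 - {0}"
  using absolutely_integrable_sphere_sgn[OF assms] by (rule set_lebesgue_integral_eq_integral(1))

lemma sphere_int_cong:
  fixes f g :: "'a::euclidean_space \<Rightarrow> real"
  assumes "\<And>\<theta>. \<theta> \<in> sphere 0 1 \<Longrightarrow> f \<theta> = g \<theta>"
  shows "sphere_int f = sphere_int g"
proof -
  have "integral (ball 0 1 - {0}) (\<lambda>x. f (sgn x)) = integral (ball 0 1 - {0}) (\<lambda>x. g (sgn x))"
    by (rule integral_cong) (auto simp: norm_sgn assms)
  then show ?thesis
    by (simp add: sphere_int_sgn)
qed

lemma sphere_int_mono:
  fixes f g :: "'a::euclidean_space \<Rightarrow> real"
  assumes "continuous_on (sphere 0 1) f" "continuous_on (sphere 0 1) g"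
    and "\<And>\<theta>. \<theta> \<in> sphere 0 1 \<Longrightarrow> f \<theta> \<le> g \<theta>"
  shows "sphere_int f \<le> sphere_int g"
proof -
  have "integral (ball 0 1 - {0}) (\<lambda>x. f (sgn x)) \<le> integral (ball 0 1 - {0}) (\<lambda>x. g (sgn x))"
    by (intro integral_le integrable_sphere_sgn assms) (auto simp: norm_sgn)
  then show ?thesis
    by (simp add: sphere_int_sgn mult_left_mono)
qed

lemma sphere_int_add:
  fixes f g :: "'a::euclidean_space \<Rightarrow> real"
  assumes "continuous_on (sphere 0 1) f" "continuous_on (sphere 0 1) g"
  shows "sphere_int (\<lambda>\<theta>. f \<theta> + g \<theta>) = sphere_int f + sphere_int g"
  using assms by (simp add: sphere_int_sgn integral_add integrable_sphere_sgn distrib_left)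

lemma sphere_int_cmult: "sphere_int (\<lambda>\<theta>. c * f \<theta>) = c * sphere_int f"
  by (simp add: sphere_int_def)

lemma sphere_int_diff:
  fixes f g :: "'a::euclidean_space \<Rightarrow> real"
  assumes "continuous_on (sphere 0 1) f" "continuous_on (sphere 0 1) g"
  shows "sphere_int (\<lambda>\<theta>. f \<theta> - g \<theta>) = sphere_int f - sphere_int g"
  using assms by (simp add: sphere_int_sgn integral_diff integrable_sphere_sgn right_diff_distrib)

lemma sphere_int_const: "sphere_int (\<lambda>_::'a::euclidean_space. c) = c * omega TYPE('a)"
  using sphere_int_cmult[of c "\<lambda>_::'a. 1"] by (simp add: omega_def)

lemma omega_eq: "omega TYPE('a::euclidean_space) = real DIM('a) * measure lebesgue (ball (0::'a) 1)"
  unfolding omega_def sphere_int_def using lmeasure_integral[OF lmeasurable_ball, of "0::'a" 1] by metis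

lemma omega_pos: "0 < omega TYPE('a::euclidean_space)"
  using measure_open_pos[of "ball (0::'a) 1"] unfolding omega_eq by simp

lemma sphere_int_nonneg:
  fixes f :: "'a::euclidean_space \<Rightarrow> real"
  assumes "continuous_on (sphere 0 1) f" "\<And>\<theta>. \<theta> \<in> sphere 0 1 \<Longrightarrow> 0 \<le> f \<theta>"
  shows "0 \<le> sphere_int f"
  using sphere_int_mono[of "\<lambda>_. 0" f] assms by (simp add: sphere_int_const)

text \<open>If f(\<theta>) were positive, \<open>f\<close> composed with \<open>sgn\<close> would
  exceed half that value on a non-empty open part of the ball, which has positive volume.\<close>

lemma sphere_int_eq_0_imp:
  fixes f :: "'a::euclidean_space \<Rightarrow> real"
  assumes f: "continuous_on (sphere 0 1) f" and nn: "\<And>\<theta>. \<theta> \<in> sphere 0 1 \<Longrightarrow> 0 \<le> f \<theta>"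
    and 0: "sphere_int f = 0" and \<theta>: "\<theta> \<in> sphere 0 1"
  shows "f \<theta> = 0"
proof (rule ccontr)
  assume "f \<theta> \<noteq> 0"
  define c where "c = f \<theta> / 2"
  have c: "0 < c" "c < f \<theta>"
    using nn[OF \<theta>] \<open>f \<theta> \<noteq> 0\<close> by (auto simp: c_def)
  let ?W = "(ball 0 1 - {0}) \<inter> (\<lambda>x. f (sgn x)) -` {c<..}"
  have W: "open ?W" "bounded ?W"
  proof -
    have "continuous_on (ball 0 1 - {0}) (\<lambda>x::'a. f (sgn x))"
      by (rule continuous_on_subset[OF continuous_on_sphere_sgn[OF f]]) auto
    then show "open ?W"
      by (rule continuous_open_preimage) auto
    show "bounded ?W"
      by (rule bounded_subset[OF bounded_ball]) auto
  qed
  have "(1/2) *\<^sub>R \<theta> \<in> ?W"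
    using \<theta> c by (auto simp: sgn_scaleR sgn_div_norm)
  then have "0 < measure lebesgue ?W"
    using measure_open_pos[OF W] by blast
  moreover have "c * measure lebesgue ?W \<le> integral (ball 0 1 - {0}) (\<lambda>x. f (sgn x))"
  proof -
    have Wm: "?W \<in> lmeasurable"
      using W by (rule lmeasurable_open_bounded)
    have int: "(\<lambda>x. f (sgn x)) integrable_on ?W"
      by (rule set_lebesgue_integral_eq_integral(1)[OF set_integrable_subset[OF
            absolutely_integrable_sphere_sgn[OF f]]]) (use Wm in \<open>auto simp: fmeasurable_def\<close>)
    have "c * measure lebesgue ?W = c * integral ?W (\<lambda>x. 1)"
      by (simp only: lmeasure_integral[OF Wm])
    also have "\<dots> = integral ?W (\<lambda>x. c)"
      using integral_mult_right[of ?W c "\<lambda>x. 1"] by simp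
    also have "\<dots> \<le> integral ?W (\<lambda>x. f (sgn x))"
      by (rule integral_le[OF integrable_on_const[OF Wm] int]) auto
    also have "\<dots> \<le> integral (ball 0 1 - {0}) (\<lambda>x. f (sgn x))"
      by (rule integral_subset_le[OF _ int integrable_sphere_sgn[OF f]]) (auto simp: norm_sgn nn)
    finally show ?thesis .
  qed
  moreover have "integral (ball 0 1 - {0}) (\<lambda>x. f (sgn x)) = 0"
    using 0 by (simp add: sphere_int_sgn)
  ultimately show False
    using c(1) by (metis mult_pos_pos not_le)
qed

section \<open>Volume in polar coordinates\<close>

text \<open>Since \<open>sphere_int\<close> is itself an integral over the unit ball, the claim
  compares a volume with such an integral. Space is cut into cones on which \<open>w\<close> varies
  by less than 1 / M; in each cone the region lies between two dilates of the same sector of the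
  ball, and dilation by t multiplies volume by t^N, N being the dimension.\<close>

lemma measure_star_region:
  fixes w :: "'a::euclidean_space \<Rightarrow> real"
  assumes w: "continuous_on (sphere 0 1) w" and nn: "\<And>\<theta>. \<theta> \<in> sphere 0 1 \<Longrightarrow> 0 \<le> w \<theta>"
  defines "S \<equiv> {x. x \<noteq> 0 \<and> norm x < w (sgn x)}"
  shows "open S" "bounded S" "measure lebesgue S = sphere_int (\<lambda>\<theta>. w \<theta> ^ DIM('a)) / DIM('a)"
proof -
  have wc: "continuous_on (- {0}) (\<lambda>x. w (sgn x))"
    by (rule continuous_on_sphere_sgn[OF w])
  have sg: "sgn x \<in> sphere 0 1" if "x \<noteq> 0" for x :: 'a
    using that by (simp add: norm_sgn)
  have S_eq: "S = (- {0}) \<inter> (\<lambda>x. w (sgn x) - norm x) -` {0<..}"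
    by (auto simp: S_def)
  show "open S"
    unfolding S_eq by (rule continuous_open_preimage) (auto intro!: continuous_intros wc)
  have "bounded (w ` sphere 0 1)"
    using w by (intro compact_imp_bounded compact_continuous_image) auto
  then obtain R where R: "0 < R" "\<And>\<theta>. \<theta> \<in> sphere 0 1 \<Longrightarrow> norm (w \<theta>) \<le> R"
    unfolding bounded_pos by blast
  then have R: "0 < R" "\<And>x. x \<noteq> 0 \<Longrightarrow> w (sgn x) \<le> R"
    using sg by (auto simp: abs_le_iff)
  show bS: "bounded S"
    unfolding bounded_iff S_def using R(2) by (force intro!: exI[of _ R])
  let ?B = "ball (0::'a) 1 - {0}"
  let ?I = "integral ?B (\<lambda>x. w (sgn x) ^ DIM('a))"
  have close: "\<bar>measure lebesgue S - ?I\<bar> \<le> e * measure lebesgue (ball (0::'a) 1)" if e: "0 < e" for e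
  proof -
    \<comment> \<open>The range up to R + 2 accommodates the outer radii: k \<le> M R + 1 and 1
      \<le> M give (k + 1) / M \<le> R + 2.\<close>
    have "uniformly_continuous_on {0..R + 2} (\<lambda>t::real. t ^ DIM('a))"
      by (intro compact_uniformly_continuous continuous_intros) auto
    then obtain d where d: "0 < d" "\<And>s t. s \<in> {0..R + 2} \<Longrightarrow> t \<in> {0..R + 2} \<Longrightarrow> \<bar>s - t\<bar> < d \<Longrightarrow>
        \<bar>s ^ DIM('a) - t ^ DIM('a)\<bar> < e"
      unfolding uniformly_continuous_on_def dist_real_def using e by metis
    obtain M :: nat where M: "0 < M" "1 / M < min d 1"
      using reals_Archimedean[of "min d 1"] d(1) by (metis One_nat_def inverse_eq_divide min_less_iff_conj zero_less_Suc zero_less_one)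
    define K where "K = nat \<lceil>M * R\<rceil> + 1"
    define C where "C k = {x::'a. x \<noteq> 0 \<and> real k \<le> M * w (sgn x) \<and> M * w (sgn x) < real k + 1}" for k :: nat
    have C_meas: "C k \<in> sets lebesgue" for k
    proof -
      have *: "open ((- {0}) \<inter> (\<lambda>x. M * w (sgn x)) -` {..<c})" for c :: real
        by (rule continuous_open_preimage) (auto intro!: continuous_intros wc)
      have eq: "C k = (- {0}) \<inter> (\<lambda>x. M * w (sgn x)) -` {..<real k + 1} - (- {0}) \<inter> (\<lambda>x. M * w (sgn x)) -` {..<real k}"
        by (auto simp: C_def)
      show ?thesis
        unfolding eq using *[THEN borel_open] by (intro sets.Diff sets_completionI_sets) simp_all
    qed
    define j where "j x = nat \<lfloor>M * w (sgn x)\<rfloor>" for x :: 'a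
    have C_iff: "x \<in> C k \<longleftrightarrow> k = j x" if x: "x \<noteq> 0" for x k
    proof -
      have "0 \<le> M * w (sgn x)"
        using nn[OF sg[OF x]] by simp
      then have "k = j x \<longleftrightarrow> int k = \<lfloor>M * w (sgn x)\<rfloor>"
        unfolding j_def by auto
      also have "\<dots> \<longleftrightarrow> real k \<le> M * w (sgn x) \<and> M * w (sgn x) < real k + 1"
        by (metis floor_eq_iff of_int_of_nat_eq)
      finally show ?thesis
        using x by (simp add: C_def)
    qed
    have j_less: "j x < K" if x: "x \<noteq> 0" for x
    proof -
      have "M * w (sgn x) \<le> M * R"
        using R(2)[OF x] by (simp add: mult_left_mono)
      then have "\<lfloor>M * w (sgn x)\<rfloor> \<le> \<lceil>M * R\<rceil>"
        by linarith
      then show ?thesis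
        unfolding j_def K_def by linarith
    qed
    have K_bound: "(real k + 1) / M \<le> R + 2" if "k < K" for k
    proof -
      have "0 \<le> M * R"
        using R(1) by simp
      then have "int k \<le> \<lceil>M * R\<rceil>"
        using that unfolding K_def by linarith
      then have "real k \<le> M * R + 1"
        by linarith
      moreover have "1 \<le> real M"
        using M by simp
      ultimately have "real k + 1 \<le> (R + 2) * M"
        by (simp add: algebra_simps)
      then show ?thesis
        using M by (simp add: pos_divide_le_eq)
    qed
    define b where "b k = measure lebesgue (C k \<inter> ball 0 1)" for k
    have C_ball: "C k \<inter> ball 0 t \<in> lmeasurable" for k t
      by (subst Int_commute) (rule fmeasurable_Int_fmeasurable[OF lmeasurable_ball C_meas])
    have scale: "measure lebesgue (C k \<inter> ball 0 t) = t ^ DIM('a) * b k" if t: "0 \<le> t" for k t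
    proof (cases "t = 0")
      case False
      then have "0 < t" using t by simp
      have "x \<in> (\<lambda>x. t *\<^sub>R x) ` (C k \<inter> ball 0 1)" if x: "x \<in> C k \<inter> ball 0 t" for x
      proof (rule image_eqI)
        show "x = t *\<^sub>R ((1 / t) *\<^sub>R x)"
          using False by simp
        show "(1 / t) *\<^sub>R x \<in> C k \<inter> ball 0 1"
          using x \<open>0 < t\<close> by (auto simp: C_def sgn_scaleR)
      qed
      moreover have "t *\<^sub>R x \<in> C k \<inter> ball 0 t" if x: "x \<in> C k \<inter> ball 0 1" for x
        using x \<open>0 < t\<close> by (auto simp: C_def sgn_scaleR)
      ultimately have "C k \<inter> ball 0 t = (\<lambda>x. t *\<^sub>R x + 0) ` (C k \<inter> ball 0 1)"
        by (simp only: add_0_right) blast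
      then show ?thesis
        unfolding b_def using measure_lebesgue_affine[of t 0 "C k \<inter> ball 0 1"] t by simp
    qed simp
    \<comment> \<open>\<open>L\<close> and \<open>U\<close> are the total volumes of the inner and
      of the outer sectors. Both the volume of \<open>S\<close> and the integral lie between them,
      and their difference is at most \<open>e\<close> times the volume of the ball.\<close>
    define L where "L = (\<Sum>k<K. (k / M) ^ DIM('a) * b k)"
    define U where "U = (\<Sum>k<K. ((real k + 1) / M) ^ DIM('a) * b k)"
    have Sm: "S \<in> lmeasurable"
      by (rule lmeasurable_open_bounded[OF \<open>open S\<close> bS])
    have SCm: "S \<inter> C k \<in> lmeasurable" for k
      by (intro fmeasurable_Int_fmeasurable Sm C_meas)
    have "measure lebesgue S = (\<Sum>k<K. measure lebesgue (S \<inter> C k))"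
    proof -
      have "S = (\<Union>k\<in>{..<K}. S \<inter> C k)"
      proof (rule set_eqI)
        fix x show "x \<in> S \<longleftrightarrow> x \<in> (\<Union>k\<in>{..<K}. S \<inter> C k)"
          using j_less[of x] C_iff[of x] by (cases "x = 0") (auto simp: S_def)
      qed
      moreover have "measure lebesgue (\<Union>k\<in>{..<K}. S \<inter> C k) = (\<Sum>k<K. measure lebesgue (S \<inter> C k))"
      proof (rule measure_finite_Union)
        show "disjoint_family_on (\<lambda>k. S \<inter> C k) {..<K}"
          unfolding disjoint_family_on_def
        proof (intro ballI impI equals0I)
          fix k l x assume "k \<noteq> l" "x \<in> S \<inter> C k \<inter> (S \<inter> C l)"
          then show False
            using C_iff[of x k] C_iff[of x l] by (auto simp: S_def)
        qed
        show "emeasure lebesgue (S \<inter> C k) \<noteq> \<infinity>" for k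
          using fmeasurableD2[OF SCm] by (simp del: emeasure_completion)
      qed (use SCm in auto)
      ultimately show ?thesis
        by simp
    qed
    moreover have "(k / M) ^ DIM('a) * b k \<le> measure lebesgue (S \<inter> C k)" for k
    proof -
      have "C k \<inter> ball 0 (k / M) \<subseteq> S \<inter> C k"
      proof
        fix x assume x: "x \<in> C k \<inter> ball 0 (k / M)"
        then have "M * norm x < real k" "real k \<le> M * w (sgn x)"
          using M by (auto simp: C_def pos_less_divide_eq mult.commute)
        then have "M * norm x < M * w (sgn x)"
          by linarith
        then show "x \<in> S \<inter> C k"
          using x M by (auto simp: S_def C_def)
      qed
      then show ?thesis
        using measure_mono_fmeasurable[OF _ fmeasurableD[OF C_ball] SCm] scale[of "k / M" k] by force
    qed
    moreover have "measure lebesgue (S \<inter> C k) \<le> ((real k + 1) / M) ^ DIM('a) * b k" for k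
    proof -
      have "S \<inter> C k \<subseteq> C k \<inter> ball 0 ((real k + 1) / M)"
      proof
        fix x assume x: "x \<in> S \<inter> C k"
        then have "M * norm x < M * w (sgn x)" "M * w (sgn x) < real k + 1"
          using M by (auto simp: S_def C_def)
        then have "norm x * M < real k + 1"
          by (simp add: mult.commute)
        then show "x \<in> C k \<inter> ball 0 ((real k + 1) / M)"
          using x M by (simp add: pos_less_divide_eq)
      qed
      then show ?thesis
        using measure_mono_fmeasurable[OF _ fmeasurableD[OF SCm] C_ball] scale[of "(real k + 1) / M" k] by force
    qed
    ultimately have S_LU: "L \<le> measure lebesgue S" "measure lebesgue S \<le> U"
      unfolding L_def U_def by (simp_all add: sum_mono)
    have step: "(\<lambda>x. \<Sum>k<K. c k * indicator (C k) x) integrable_on ?B"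
        "integral ?B (\<lambda>x. \<Sum>k<K. c k * indicator (C k) x) = (\<Sum>k<K. c k * b k)" for c :: "nat \<Rightarrow> real"
    proof -
      have eq: "C k \<inter> ?B = C k \<inter> ball 0 1" for k
        by (auto simp: C_def)
      have ind: "(indicator (C k) has_integral b k) ?B" for k
        using C_ball[of k 1] unfolding b_def eq[symmetric] has_integral_iff
        by (simp add: integral_indicator integrable_on_indicator)
      have "((\<lambda>x. \<Sum>k<K. c k * indicator (C k) x) has_integral (\<Sum>k<K. c k * b k)) ?B"
        by (intro has_integral_sum has_integral_mult_right ind) simp
      then show "(\<lambda>x. \<Sum>k<K. c k * indicator (C k) x) integrable_on ?B"
        "integral ?B (\<lambda>x. \<Sum>k<K. c k * indicator (C k) x) = (\<Sum>k<K. c k * b k)"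
        by (auto simp: has_integral_iff)
    qed
    have step_eq: "(\<Sum>k<K. c k * indicator (C k) x) = c (j x)" if x: "x \<noteq> 0" for c :: "nat \<Rightarrow> real" and x
    proof -
      have "(\<Sum>k<K. c k * indicator (C k) x) = (\<Sum>k<K. if k = j x then c k else 0)"
        by (intro sum.cong) (auto simp: indicator_def C_iff[OF x])
      then show ?thesis
        using j_less[OF x] by simp
    qed
    have wint: "(\<lambda>x. w (sgn x) ^ DIM('a)) integrable_on ?B"
      by (rule integrable_sphere_sgn) (intro continuous_intros w)
    have jw: "j x / M \<le> w (sgn x)" "w (sgn x) \<le> (real (j x) + 1) / M" if x: "x \<noteq> 0" for x
      using C_iff[OF x, of "j x"] M by (auto simp: C_def divide_le_eq le_divide_eq mult.commute)
    have I_LU: "L \<le> ?I" "?I \<le> U"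
    proof -
      show "L \<le> ?I"
        unfolding L_def step(2)[symmetric]
      proof (rule integral_le[OF step(1) wint])
        fix x assume "x \<in> ?B"
        then have x: "x \<noteq> 0" by simp
        show "(\<Sum>k<K. (k / M) ^ DIM('a) * indicator (C k) x) \<le> w (sgn x) ^ DIM('a)"
          unfolding step_eq[OF x] using jw[OF x] by (intro power_mono) auto
      qed
      show "?I \<le> U"
        unfolding U_def step(2)[symmetric]
      proof (rule integral_le[OF wint step(1)])
        fix x assume "x \<in> ?B"
        then have x: "x \<noteq> 0" by simp
        show "w (sgn x) ^ DIM('a) \<le> (\<Sum>k<K. ((real k + 1) / M) ^ DIM('a) * indicator (C k) x)"
          unfolding step_eq[OF x] using jw[OF x] nn[OF sg[OF x]] by (intro power_mono) auto
      qed
    qed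
    have "U - L = (\<Sum>k<K. (((real k + 1) / M) ^ DIM('a) - (k / M) ^ DIM('a)) * b k)"
      unfolding U_def L_def by (simp add: sum_subtractf left_diff_distrib)
    also have "\<dots> \<le> (\<Sum>k<K. e * b k)"
    proof (intro sum_mono mult_right_mono)
      fix k assume k: "k \<in> {..<K}"
      have "real k / M \<le> (real k + 1) / M"
        by (simp add: divide_right_mono)
      moreover have "(real k + 1) / M - real k / M < d"
        using M by (simp add: add_divide_distrib)
      ultimately have "\<bar>((real k + 1) / M) ^ DIM('a) - (real k / M) ^ DIM('a)\<bar> < e"
        using K_bound[of k] k by (intro d(2)) (auto intro: order_trans)
      then show "((real k + 1) / M) ^ DIM('a) - (k / M) ^ DIM('a) \<le> e"
        by linarith
    qed (simp add: b_def)
    also have "\<dots> = e * (\<Sum>k<K. b k)"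
      by (simp add: sum_distrib_left)
    also have "(\<Sum>k<K. b k) = measure lebesgue ?B"
    proof -
      have "(\<Sum>k<K. b k) = integral ?B (\<lambda>x. \<Sum>k<K. 1 * indicator (C k) x)"
        unfolding step(2) by simp
      also have "\<dots> = integral ?B (\<lambda>x. 1)"
        by (rule integral_cong) (subst step_eq[where c = "\<lambda>_. 1"], auto)
      also have "\<dots> = measure lebesgue ?B"
        by (rule lmeasure_integral[OF lmeasurable_punctured_ball, symmetric])
      finally show ?thesis .
    qed
    also have "measure lebesgue ?B \<le> measure lebesgue (ball (0::'a) 1)"
      by (rule measure_mono_fmeasurable) auto
    finally have "U - L \<le> e * measure lebesgue (ball (0::'a) 1)"
      using e by simp
    then show ?thesis
      using S_LU I_LU by linarith
  qed
  have "\<bar>measure lebesgue S - ?I\<bar> \<le> 0"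
  proof (rule field_le_epsilon)
    fix e :: real assume e: "0 < e"
    have B: "0 < measure lebesgue (ball (0::'a) 1)"
      by (rule measure_open_pos) auto
    show "\<bar>measure lebesgue S - ?I\<bar> \<le> 0 + e"
      using close[of "e / measure lebesgue (ball (0::'a) 1)"] e B by (simp del: measure_completion)
  qed
  then show "measure lebesgue S = sphere_int (\<lambda>\<theta>. w \<theta> ^ DIM('a)) / DIM('a)"
    by (simp add: sphere_int_sgn)
qed

section \<open>The isoperimetric inequality for star bodies\<close>

text \<open>The extension of \<open>u\<close> is invariant under dilations; the chain rule for y ->
  y / t then makes its gradient homogeneous of degree -1.\<close>

lemma gradient_homogeneous:
  fixes u :: "'a::euclidean_space \<Rightarrow> real"
  assumes der: "\<And>x. x \<noteq> 0 \<Longrightarrow> ((\<lambda>y. u (sgn y)) has_derivative (\<lambda>h. Du x \<bullet> h)) (at x)"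
    and x: "x \<noteq> 0" and t: "0 < t"
  shows "Du (t *\<^sub>R x) = Du x /\<^sub>R t"
proof -
  have "((\<lambda>y. u (sgn ((1 / t) *\<^sub>R y))) has_derivative (\<lambda>h. Du x \<bullet> ((1 / t) *\<^sub>R h))) (at (t *\<^sub>R x))"
    using der[OF x] t
    by (intro has_derivative_compose[of "\<lambda>y. (1 / t) *\<^sub>R y" _ _ _ "\<lambda>y. u (sgn y)"]) (auto intro!: derivative_eq_intros)
  moreover have "u (sgn ((1 / t) *\<^sub>R y)) = u (sgn y)" for y
    using t by (simp add: sgn_scaleR)
  ultimately have "((\<lambda>y. u (sgn y)) has_derivative (\<lambda>h. Du x \<bullet> ((1 / t) *\<^sub>R h))) (at (t *\<^sub>R x))"
    by simp
  moreover have "((\<lambda>y. u (sgn y)) has_derivative (\<lambda>h. Du (t *\<^sub>R x) \<bullet> h)) (at (t *\<^sub>R x))"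
    using der[of "t *\<^sub>R x"] x t by simp
  ultimately have eq: "(\<lambda>h. Du x \<bullet> ((1 / t) *\<^sub>R h)) = (\<lambda>h. Du (t *\<^sub>R x) \<bullet> h)"
    by (rule has_derivative_unique)
  have "Du (t *\<^sub>R x) \<bullet> h = (Du x /\<^sub>R t) \<bullet> h" for h
    using fun_cong[OF eq, of h] by (simp add: inverse_eq_divide)
  then show ?thesis
    by (metis inner_diff_left eq_iff_diff_eq_0 inner_eq_zero_iff)
qed

text \<open>The extension of \<open>u\<close> is constant along rays, so its radial derivative
  vanishes.\<close>

lemma gradient_orthogonal:
  fixes u :: "'a::euclidean_space \<Rightarrow> real"
  assumes der: "\<And>x. x \<noteq> 0 \<Longrightarrow> ((\<lambda>y. u (sgn y)) has_derivative (\<lambda>h. Du x \<bullet> h)) (at x)"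
    and x: "x \<noteq> 0"
  shows "Du x \<bullet> x = 0"
proof -
  have "((\<lambda>t. u (sgn (t *\<^sub>R x))) has_derivative (\<lambda>s. Du x \<bullet> (s *\<^sub>R x))) (at 1)"
    using der[OF x]
    by (intro has_derivative_compose[of "\<lambda>t. t *\<^sub>R x" _ _ _ "\<lambda>y. u (sgn y)"]) (auto intro!: derivative_eq_intros)
  moreover have "((\<lambda>t::real. u (sgn (t *\<^sub>R x))) has_derivative (\<lambda>s. 0)) (at 1)"
  proof (rule has_derivative_transform_within_open)
    show "((\<lambda>t::real. u (sgn x)) has_derivative (\<lambda>s. 0)) (at 1)"
      by simp
    show "open {0::real<..}" by simp
  qed (auto simp: sgn_scaleR)
  ultimately have eq: "(\<lambda>s. Du x \<bullet> (s *\<^sub>R x)) = (\<lambda>s::real. 0)"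
    by (rule has_derivative_unique)
  show ?thesis
    using fun_cong[OF eq, of 1] by simp
qed

lemma gauge_has_derivative:
  fixes u :: "'a::euclidean_space \<Rightarrow> real"
  assumes der: "\<And>x. x \<noteq> 0 \<Longrightarrow> ((\<lambda>y. u (sgn y)) has_derivative (\<lambda>h. Du x \<bullet> h)) (at x)"
    and x: "x \<noteq> 0" and u: "u (sgn x) \<noteq> 0"
  shows "((\<lambda>y. norm y / u (sgn y)) has_derivative
      (\<lambda>h. ((1 / u (sgn x)) *\<^sub>R sgn x - (norm x / (u (sgn x))\<^sup>2) *\<^sub>R Du x) \<bullet> h)) (at x)"
  by (rule has_derivative_eq_rhs, rule has_derivative_divide'[OF has_derivative_norm[OF x] der[OF x] u])
    (use u in \<open>auto simp: fun_eq_iff inner_diff_left inner_diff_right field_simps power2_eq_square inner_commute\<close>)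

text \<open>The vector is the gradient of the gauge. Its radial and tangential parts are orthogonal,
  and it is homogeneous of degree 0, so its norm depends on \<open>sgn x\<close> alone; times u^N
  this norm is the Euclidean area density.\<close>

lemma norm_gauge_gradient:
  fixes u :: "'a::euclidean_space \<Rightarrow> real"
  assumes der: "\<And>x. x \<noteq> 0 \<Longrightarrow> ((\<lambda>y. u (sgn y)) has_derivative (\<lambda>h. Du x \<bullet> h)) (at x)"
    and x: "x \<noteq> 0" and u: "0 < u (sgn x)"
  shows "norm ((1 / u (sgn x)) *\<^sub>R sgn x - (norm x / (u (sgn x))\<^sup>2) *\<^sub>R Du x)
      = sqrt ((u (sgn x))\<^sup>2 + (norm (Du (sgn x)))\<^sup>2) / (u (sgn x))\<^sup>2"
proof -
  let ?u = "u (sgn x)"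
  have "Du (sgn x) = Du x /\<^sub>R inverse (norm x)"
    unfolding sgn_div_norm using x by (intro gradient_homogeneous[OF der]) auto
  then have eq: "norm x *\<^sub>R Du x = Du (sgn x)"
    by simp
  have s: "sgn x \<noteq> 0" "norm (sgn x) = 1"
    using x by (auto simp: norm_sgn sgn_zero_iff)
  have "Du (sgn x) \<bullet> sgn x = 0"
    by (rule gradient_orthogonal[OF der s(1)])
  then have "orthogonal (?u *\<^sub>R sgn x) (- Du (sgn x))"
    by (simp add: orthogonal_def inner_commute)
  then have "(norm (?u *\<^sub>R sgn x + - Du (sgn x)))\<^sup>2 = (norm (?u *\<^sub>R sgn x))\<^sup>2 + (norm (- Du (sgn x)))\<^sup>2"
    by (rule norm_add_Pythagorean)
  then have "norm (?u *\<^sub>R sgn x - Du (sgn x)) = sqrt (?u\<^sup>2 + (norm (Du (sgn x)))\<^sup>2)"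
    using s by (intro real_sqrt_unique[symmetric]) (auto simp: power_mult_distrib)
  moreover have "(1 / ?u) *\<^sub>R sgn x - (norm x / ?u\<^sup>2) *\<^sub>R Du x = (1 / ?u\<^sup>2) *\<^sub>R (?u *\<^sub>R sgn x - Du (sgn x))"
    using u eq by (simp add: scaleR_diff_right power2_eq_square eq[symmetric])
  ultimately show ?thesis
    using u by simp
qed

text \<open>The constant is uniform for t in a bounded range, so that the volume of an enlarged star
  body is controlled to first order in the enlargement with a quadratic error.\<close>

lemma power_add_le_quadratic:
  fixes T :: real
  assumes "0 \<le> T"
  shows "\<exists>c\<ge>0. \<forall>t\<in>{0..T}. (1 + t) ^ N \<le> 1 + real N * t + c * t\<^sup>2"
proof (induction N)
  case 0
  then show ?case by (auto intro!: exI[of _ 0])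
next
  case (Suc N)
  then obtain c where c: "0 \<le> c" "\<And>t. t \<in> {0..T} \<Longrightarrow> (1 + t) ^ N \<le> 1 + real N * t + c * t\<^sup>2"
    by blast
  have "(1 + t) ^ Suc N \<le> 1 + real (Suc N) * t + (N + c * (1 + T)) * t\<^sup>2" if t: "t \<in> {0..T}" for t
  proof -
    have "(1 + t) ^ Suc N \<le> (1 + t) * (1 + real N * t + c * t\<^sup>2)"
      using c(2)[OF t] t by (simp add: mult_left_mono)
    also have "\<dots> = 1 + real (Suc N) * t + (N + c * (1 + t)) * t\<^sup>2"
      by (simp add: algebra_simps power2_eq_square)
    also have "\<dots> \<le> 1 + real (Suc N) * t + (N + c * (1 + T)) * t\<^sup>2"
      using t c(1) by (intro add_left_mono mult_right_mono mult_left_mono) auto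
    finally show ?thesis .
  qed
  then show ?case
    using c(1) assms by (intro exI[of _ "N + c * (1 + T)"]) auto
qed

text \<open>The matching first-order bound from below, for the Brunn-Minkowski side.\<close>

lemma power_add_ge_linear:
  fixes x y :: real
  assumes "0 \<le> x" "0 \<le> y"
  shows "x ^ N + real N * y * x ^ (N - 1) \<le> (x + y) ^ N"
proof (induction N)
  case (Suc N)
  have "x ^ Suc N + real (Suc N) * y * x ^ N \<le> (x + y) * (x ^ N + real N * y * x ^ (N - 1))"
  proof (cases N)
    case (Suc k)
    have "0 \<le> real N * y\<^sup>2 * x ^ k"
      using assms by simp
    then show ?thesis
      unfolding Suc by (simp add: algebra_simps power2_eq_square)
  qed (simp add: algebra_simps)
  also have "\<dots> \<le> (x + y) * (x + y) ^ N"
    using Suc assms by (intro mult_left_mono) auto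
  finally show ?case by simp
qed simp


text \<open>If a step of length less than \<open>\<epsilon>\<close> leads out of the star body to a point \<open>z\<close>, then by the mean value
  theorem the gauge \<open>p x = norm x / u (sgn x)\<close> satisfies \<open>p z < 1 + \<epsilon> * (norm (grad p z) + \<eta>)\<close>.
  Here \<open>q\<close> is \<open>norm (grad p)\<close> on the sphere.\<close>
lemma star_region_plus_ball_subset:
  fixes u :: "'a::euclidean_space \<Rightarrow> real"
  assumes der: "\<And>x. x \<noteq> 0 \<Longrightarrow> ((\<lambda>y. u (sgn y)) has_derivative (\<lambda>h. Du x \<bullet> h)) (at x)"
    and Du: "continuous_on (- {0}) Du" and u: "\<And>\<theta>. \<theta> \<in> sphere 0 1 \<Longrightarrow> 0 < u \<theta>"
    and uc: "continuous_on (sphere 0 1) u" and \<eta>: "0 < \<eta>"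
  defines "q \<equiv> \<lambda>\<theta>. sqrt ((u \<theta>)\<^sup>2 + (norm (Du \<theta>))\<^sup>2) / (u \<theta>)\<^sup>2"
  shows "\<exists>\<epsilon>0>0. \<forall>\<epsilon>\<in>{0<..<\<epsilon>0}. {x. x \<noteq> 0 \<and> norm x < u (sgn x)} + ball 0 \<epsilon>
      \<subseteq> insert 0 {x. x \<noteq> 0 \<and> norm x < u (sgn x) * (1 + \<epsilon> * (q (sgn x) + \<eta>))}"
proof -
  let ?S = "sphere (0::'a) 1"
  have sg: "sgn x \<in> ?S" if "x \<noteq> 0" for x :: 'a
    using that by (simp add: norm_sgn)
  define P where "P x = (1 / u (sgn x)) *\<^sub>R sgn x - (norm x / (u (sgn x))\<^sup>2) *\<^sub>R Du x" for x
  define p where "p x = norm x / u (sgn x)" for x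
  have p_der: "(p has_derivative (\<lambda>h. P x \<bullet> h)) (at x)" if x: "x \<noteq> 0" for x
    unfolding p_def P_def using u[OF sg[OF x]] by (intro gauge_has_derivative der x) auto
  have P_norm: "norm (P x) = q (sgn x)" if x: "x \<noteq> 0" for x
    unfolding P_def q_def using u[OF sg[OF x]] by (intro norm_gauge_gradient der x) auto
  have P_cont: "continuous_on (- {0}) P"
  proof -
    have "continuous_on (- {0}) (\<lambda>x. u (sgn x))"
      by (rule continuous_on_sphere_sgn[OF uc])
    moreover have "u (sgn x) \<noteq> 0" if "x \<in> - {0}" for x
      using u[OF sg[of x]] that by auto
    ultimately show ?thesis
      unfolding P_def by (intro continuous_intros Du) auto
  qed
  have S: "compact ?S" "?S \<noteq> {}"
    by auto
  obtain \<theta>0 where \<theta>0: "\<theta>0 \<in> ?S" "\<And>\<theta>. \<theta> \<in> ?S \<Longrightarrow> u \<theta>0 \<le> u \<theta>"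
    using continuous_attains_inf[OF S uc] by blast
  obtain \<theta>1 where \<theta>1: "\<theta>1 \<in> ?S" "\<And>\<theta>. \<theta> \<in> ?S \<Longrightarrow> u \<theta> \<le> u \<theta>1"
    using continuous_attains_sup[OF S uc] by blast
  define \<rho> where "\<rho> = u \<theta>0"
  define R where "R = u \<theta>1"
  have \<rho>: "0 < \<rho>"
    using u \<theta>0 by (simp add: \<rho>_def)
  \<comment> \<open>For \<epsilon> < \<open>\<epsilon>0\<close> this shell contains every segment of
    length less than \<epsilon> from a point of the star body to a point outside it: norms stay
    above \<rho> - \<epsilon> > \<rho> / 2 and below R + \<epsilon> < R + 1.\<close>
  define K where "K = cball 0 (R + 1) - ball (0::'a) (\<rho> / 2)"
  have K0: "x \<noteq> 0" if "x \<in> K" for x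
    using that \<rho> by (auto simp: K_def)
  have "compact K"
    unfolding K_def by (intro compact_diff) auto
  moreover have "continuous_on K P"
    by (rule continuous_on_subset[OF P_cont]) (use K0 in auto)
  ultimately have "uniformly_continuous_on K P"
    by (intro compact_uniformly_continuous)
  then obtain \<delta> where \<delta>: "0 < \<delta>" "\<And>x y. x \<in> K \<Longrightarrow> y \<in> K \<Longrightarrow> dist y x < \<delta> \<Longrightarrow> dist (P y) (P x) < \<eta>"
    unfolding uniformly_continuous_on_def using \<eta> by metis
  define \<epsilon>0 where "\<epsilon>0 = min \<delta> (min (\<rho> / 2) 1)"
  have "0 < \<epsilon>0"
    using \<delta>(1) \<rho> by (simp add: \<epsilon>0_def)
  moreover have "z \<in> insert 0 {x. x \<noteq> 0 \<and> norm x < u (sgn x) * (1 + \<epsilon> * (q (sgn x) + \<eta>))}"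
    if \<epsilon>: "\<epsilon> \<in> {0<..<\<epsilon>0}" and z: "z \<in> {x. x \<noteq> 0 \<and> norm x < u (sgn x)} + ball 0 \<epsilon>" for z \<epsilon>
  proof (cases "z = 0")
    case False
    obtain x y where x: "x \<noteq> 0" "norm x < u (sgn x)" and y: "norm y < \<epsilon>" and zxy: "z = x + y"
      using z by (auto elim!: set_plus_elim)
    have uz: "0 < u (sgn z)"
      using u sg False by blast
    have qz: "0 \<le> q (sgn z)"
      by (simp add: q_def)
    have "p z < 1 + \<epsilon> * (q (sgn z) + \<eta>)"
    proof (cases "p z < 1")
      case True
      have "0 \<le> \<epsilon> * (q (sgn z) + \<eta>)"
        using \<epsilon> qz \<eta> by simp
      then show ?thesis
        using True by linarith
    next
      case False
      then have "u (sgn z) \<le> norm z"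
        using uz by (simp add: p_def not_less)
      then have nz: "\<rho> \<le> norm z"
        using \<theta>0(2)[OF sg[OF \<open>z \<noteq> 0\<close>]] by (simp add: \<rho>_def)
      have nx: "norm x < R"
        using x \<theta>1(2)[OF sg[OF x(1)]] by (simp add: R_def)
      have \<epsilon>': "\<epsilon> < \<delta>" "\<epsilon> < \<rho> / 2" "\<epsilon> < 1"
        using \<epsilon> by (auto simp: \<epsilon>0_def)
      have seg: "v \<in> K \<and> dist v z < \<delta>" if "v \<in> closed_segment x z" for v
      proof -
        have "dist v z \<le> dist x z" "dist v x \<le> dist x z"
          using segment_bound[OF that] by (auto simp: dist_norm norm_minus_commute)
        moreover have "dist x z < \<epsilon>"
          using y by (simp add: zxy dist_norm)
        ultimately have "norm (v - z) < \<epsilon>" "norm (v - x) < \<epsilon>" "dist v z < \<delta>"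
          using \<epsilon>' by (auto simp: dist_norm)
        moreover have "norm z \<le> norm v + norm (v - z)" "norm v \<le> norm x + norm (v - x)"
          by norm+
        ultimately show ?thesis
          using nz nx \<epsilon>' by (auto simp: K_def)
      qed
      have zK: "z \<in> K"
        using seg[of z] by simp
      \<comment> \<open>The gradient along the segment is compared with its value at
        \<open>z\<close> and not at \<open>x\<close>, because the resulting radial bound must depend
        on the direction of \<open>z\<close>.\<close>
      have "norm (p z - p x) \<le> (q (sgn z) + \<eta>) * norm (z - x)"
      proof (rule differentiable_bound)
        show "convex (closed_segment x z)" by (rule convex_closed_segment)
        fix v assume v: "v \<in> closed_segment x z"
        then have vK: "v \<in> K" and vz: "dist v z < \<delta>"
          using seg by auto
        show "(p has_derivative (\<lambda>h. P v \<bullet> h)) (at v within closed_segment x z)"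
          using p_der[OF K0[OF vK]] by (rule has_derivative_at_withinI)
        have "norm (P v) \<le> norm (P z) + norm (P v - P z)"
          by norm
        moreover have "norm (P v - P z) < \<eta>"
          using \<delta>(2)[OF zK vK vz] by (simp add: dist_norm)
        ultimately have Pv: "norm (P v) \<le> q (sgn z) + \<eta>"
          using P_norm[OF \<open>z \<noteq> 0\<close>] by linarith
        show "onorm (\<lambda>h. P v \<bullet> h) \<le> q (sgn z) + \<eta>"
        proof (rule onorm_le)
          fix h
          have "norm (P v \<bullet> h) \<le> norm (P v) * norm h"
            by (simp add: Cauchy_Schwarz_ineq2)
          also have "\<dots> \<le> (q (sgn z) + \<eta>) * norm h"
            using Pv by (rule mult_right_mono) simp
          finally show "norm (P v \<bullet> h) \<le> (q (sgn z) + \<eta>) * norm h" .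
        qed
      qed auto
      also have "\<dots> \<le> (q (sgn z) + \<eta>) * \<epsilon>"
        using y qz \<eta> by (intro mult_left_mono) (auto simp: zxy)
      finally have "p z \<le> p x + \<epsilon> * (q (sgn z) + \<eta>)"
        by (simp add: mult.commute abs_le_iff)
      moreover have "p x < 1"
        using x u[OF sg[OF x(1)]] by (simp add: p_def)
      ultimately show ?thesis
        by linarith
    qed
    then show ?thesis
      using False uz by (simp add: p_def pos_divide_less_eq mult.commute)
  qed simp
  ultimately show ?thesis
    by blast
qed

text \<open>Brunn-Minkowski for the star body and a ball of radius \<epsilon>, expanded to first
  order in \<epsilon>. The star body has volume V / N, V being the integral of u^N, and omega = N
  |B| for the unit ball B; so the left side is the classical N |B|^(1/N) (V/N)^((N-1)/N).\<close>

lemma isoperimetric_star_pos: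
  fixes u :: "'a::euclidean_space \<Rightarrow> real"
  assumes dim: "2 \<le> DIM('a)"
    and der: "\<And>x. x \<noteq> 0 \<Longrightarrow> ((\<lambda>y. u (sgn y)) has_derivative (\<lambda>h. Du x \<bullet> h)) (at x)"
    and Du: "continuous_on (- {0}) Du" and u: "\<And>\<theta>. \<theta> \<in> sphere 0 1 \<Longrightarrow> 0 < u \<theta>"
    and uc: "continuous_on (sphere 0 1) u"
  shows "root DIM('a) (omega TYPE('a)) * root DIM('a) (sphere_int (\<lambda>\<theta>. u \<theta> ^ DIM('a))) ^ (DIM('a) - 1)
    \<le> sphere_int (\<lambda>\<theta>. u \<theta> ^ (DIM('a) - 2) * sqrt ((u \<theta>)\<^sup>2 + (norm (Du \<theta>))\<^sup>2))"
proof -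
  let ?N = "DIM('a)"
  let ?S = "sphere (0::'a) 1"
  define q where "q \<theta> = sqrt ((u \<theta>)\<^sup>2 + (norm (Du \<theta>))\<^sup>2) / (u \<theta>)\<^sup>2" for \<theta>
  define V where "V = sphere_int (\<lambda>\<theta>. u \<theta> ^ ?N)"
  define v where "v = root ?N V"
  define w where "w = root ?N (omega TYPE('a))"
  have Du': "continuous_on ?S Du"
    by (rule continuous_on_subset[OF Du]) auto
  have u0: "u \<theta> \<noteq> 0" if "\<theta> \<in> ?S" for \<theta>
    using u[OF that] by simp
  have qc: "continuous_on ?S q"
    unfolding q_def using u0 by (intro continuous_intros uc Du') auto
  have q0: "0 \<le> q \<theta>" for \<theta>
    by (simp add: q_def)
  have V0: "0 \<le> V"
    unfolding V_def
    by (rule sphere_int_nonneg) (use u in \<open>auto intro!: continuous_intros uc zero_le_power intro: less_imp_le\<close>)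
  then have v0: "0 \<le> v"
    by (simp add: v_def)
  have w0: "0 \<le> w"
    using omega_pos[where 'a = 'a] by (simp add: w_def)
  \<comment> \<open>\<eta> is the slack in the enlargement of the star body; it costs \<eta> V and
    is sent to 0 last, after \<epsilon>.\<close>
  have claim: "w * v ^ (?N - 1) \<le> sphere_int (\<lambda>\<theta>. u \<theta> ^ ?N * q \<theta>) + \<eta> * V" if \<eta>: "0 < \<eta>" for \<eta>
  proof -
    define k where "k \<theta> = q \<theta> + \<eta>" for \<theta>
    have kc: "continuous_on ?S k"
      unfolding k_def by (intro continuous_intros qc)
    have k0: "0 \<le> k \<theta>" for \<theta>
      using q0[of \<theta>] \<eta> by (simp add: k_def)
    have "?S \<noteq> {}" by simp
    obtain \<theta>1 where \<theta>1: "\<And>\<theta>. \<theta> \<in> ?S \<Longrightarrow> k \<theta> \<le> k \<theta>1"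
      using continuous_attains_sup[OF compact_sphere \<open>?S \<noteq> {}\<close> kc] by blast
    \<comment> \<open>The range up to the maximum of \<open>k\<close> suffices, as \<epsilon> < 1
      below.\<close>
    obtain c where c: "0 \<le> c" "\<And>t. t \<in> {0..k \<theta>1} \<Longrightarrow> (1 + t) ^ ?N \<le> 1 + real ?N * t + c * t\<^sup>2"
      using power_add_le_quadratic[OF k0] by blast
    obtain \<epsilon>0 where \<epsilon>0: "0 < \<epsilon>0" "\<And>\<epsilon>. \<epsilon> \<in> {0<..<\<epsilon>0} \<Longrightarrow> {x. x \<noteq> 0 \<and> norm x < u (sgn x)} + ball 0 \<epsilon>
        \<subseteq> insert 0 {x. x \<noteq> 0 \<and> norm x < u (sgn x) * (1 + \<epsilon> * k (sgn x))}"
      using star_region_plus_ball_subset[OF der Du u uc \<eta>] unfolding k_def q_def by blast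
    have key: "w * v ^ (?N - 1) \<le> sphere_int (\<lambda>\<theta>. u \<theta> ^ ?N * k \<theta>) + \<epsilon> * (c / ?N * sphere_int (\<lambda>\<theta>. u \<theta> ^ ?N * (k \<theta>)\<^sup>2))"
      if \<epsilon>: "\<epsilon> \<in> {0<..<min \<epsilon>0 1}" for \<epsilon>
    proof -
      have \<epsilon>1: "0 < \<epsilon>" "\<epsilon> < \<epsilon>0" "\<epsilon> < 1"
        using \<epsilon> by auto
      let ?D = "{x. x \<noteq> 0 \<and> norm x < u (sgn x)}"
      let ?E = "{x. x \<noteq> 0 \<and> norm x < u (sgn x) * (1 + \<epsilon> * k (sgn x))}"
      have u0': "0 \<le> u \<theta>" if "\<theta> \<in> ?S" for \<theta>
        using u[OF that] by simp
      have D: "open ?D" "bounded ?D" "measure lebesgue ?D = sphere_int (\<lambda>\<theta>. u \<theta> ^ ?N) / ?N"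
        by (rule measure_star_region[OF uc u0'], assumption)+
      have Ec: "continuous_on ?S (\<lambda>\<theta>. u \<theta> * (1 + \<epsilon> * k \<theta>))"
        by (intro continuous_intros uc kc)
      have E0: "0 \<le> u \<theta> * (1 + \<epsilon> * k \<theta>)" if "\<theta> \<in> ?S" for \<theta>
        using u[OF that] k0[of \<theta>] \<epsilon>1 by (intro mult_nonneg_nonneg add_nonneg_nonneg) auto
      have E: "open ?E" "bounded ?E" "measure lebesgue ?E = sphere_int (\<lambda>\<theta>. (u \<theta> * (1 + \<epsilon> * k \<theta>)) ^ ?N) / ?N"
        by (rule measure_star_region[OF Ec E0], assumption)+
      have "?D \<noteq> {}"
      proof -
        obtain \<theta> where \<theta>: "\<theta> \<in> ?S"
          using \<open>?S \<noteq> {}\<close> by (auto simp only: ex_in_conv[symmetric])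
        have "(u \<theta> / 2) *\<^sub>R \<theta> \<in> ?D"
          using \<theta> u[OF \<theta>] by (auto simp: sgn_scaleR sgn_div_norm)
        then show ?thesis by blast
      qed
      then have "(root ?N (measure lebesgue ?D) + root ?N (measure lebesgue (ball (0::'a) \<epsilon>))) ^ ?N
          \<le> measure lebesgue (?D + ball 0 \<epsilon>)"
        using \<epsilon>1 by (intro brunn_minkowski_open D(1,2)) auto
      also have "\<dots> \<le> measure lebesgue (insert 0 ?E)"
      proof (rule measure_mono_fmeasurable)
        show "?D + ball 0 \<epsilon> \<subseteq> insert 0 ?E"
          using \<epsilon>0(2) \<epsilon>1 by simp
        show "?D + ball 0 \<epsilon> \<in> sets lebesgue"
          by (intro fmeasurableD lmeasurable_open_bounded open_set_plus bounded_set_plus D) auto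
        show "insert 0 ?E \<in> lmeasurable"
          unfolding insert_is_Un[of 0 ?E]
          by (rule fmeasurable.Un[OF lmeasurable_compact lmeasurable_open_bounded[OF E(1,2)]]) simp
      qed
      also have "\<dots> = measure lebesgue ?E"
        by (rule measure_negligible_symdiff[OF lmeasurable_open_bounded[OF E(1,2)]])
          (rule negligible_subset[of "{0}"], auto)
      also have "\<dots> = sphere_int (\<lambda>\<theta>. (u \<theta> * (1 + \<epsilon> * k \<theta>)) ^ ?N) / ?N"
        by (rule E(3))
      finally have *: "(root ?N (measure lebesgue ?D) + root ?N (measure lebesgue (ball (0::'a) \<epsilon>))) ^ ?N
          \<le> sphere_int (\<lambda>\<theta>. (u \<theta> * (1 + \<epsilon> * k \<theta>)) ^ ?N) / ?N" .
      \<comment> \<open>Each volume is a sphere integral divided by N, so \<open>root ?N ?N\<close>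
        is a common factor that cancels.\<close>
      have Dv: "root ?N (measure lebesgue ?D) = v / root ?N ?N"
        unfolding D(3) v_def V_def by (simp add: real_root_divide)
      have "measure lebesgue (ball (0::'a) \<epsilon>) = \<epsilon> ^ ?N * measure lebesgue (ball (0::'a) 1)"
      proof -
        have "ball (0::'a) \<epsilon> = (\<lambda>x. \<epsilon> *\<^sub>R x + 0) ` ball 0 1"
          using \<epsilon>1(1) ball_scale[of \<epsilon> "0::'a" 1] by simp
        then show ?thesis
          using measure_lebesgue_affine[of \<epsilon> 0 "ball (0::'a) 1"] \<epsilon>1(1) by simp
      qed
      also have "measure lebesgue (ball (0::'a) 1) = omega TYPE('a) / ?N"
        by (simp add: omega_eq)
      finally have Bw: "root ?N (measure lebesgue (ball (0::'a) \<epsilon>)) = \<epsilon> * w / root ?N ?N"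
        using \<epsilon>1 by (simp add: real_root_divide real_root_mult real_root_power_cancel w_def)
      have "(v + \<epsilon> * w) ^ ?N \<le> sphere_int (\<lambda>\<theta>. (u \<theta> * (1 + \<epsilon> * k \<theta>)) ^ ?N)"
        using * unfolding Dv Bw by (simp add: add_divide_distrib[symmetric] power_divide divide_le_cancel)
      also have "\<dots> \<le> sphere_int (\<lambda>\<theta>. u \<theta> ^ ?N + (?N * \<epsilon> * (u \<theta> ^ ?N * k \<theta>) + c * \<epsilon>\<^sup>2 * (u \<theta> ^ ?N * (k \<theta>)\<^sup>2)))"
      proof (rule sphere_int_mono)
        fix \<theta> assume \<theta>: "\<theta> \<in> ?S"
        have "\<epsilon> * k \<theta> \<le> 1 * k \<theta>1"
          using \<epsilon>1 k0[of \<theta>] \<theta>1[OF \<theta>] by (intro mult_mono) auto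
        then have "(1 + \<epsilon> * k \<theta>) ^ ?N \<le> 1 + real ?N * (\<epsilon> * k \<theta>) + c * (\<epsilon> * k \<theta>)\<^sup>2"
          using \<epsilon>1 k0[of \<theta>] by (intro c) auto
        then have "u \<theta> ^ ?N * (1 + \<epsilon> * k \<theta>) ^ ?N \<le> u \<theta> ^ ?N * (1 + real ?N * (\<epsilon> * k \<theta>) + c * (\<epsilon> * k \<theta>)\<^sup>2)"
          using u[OF \<theta>] by (intro mult_left_mono) auto
        then show "(u \<theta> * (1 + \<epsilon> * k \<theta>)) ^ ?N \<le> u \<theta> ^ ?N + (?N * \<epsilon> * (u \<theta> ^ ?N * k \<theta>) + c * \<epsilon>\<^sup>2 * (u \<theta> ^ ?N * (k \<theta>)\<^sup>2))"
          unfolding power_mult_distrib[of "u \<theta>" "1 + \<epsilon> * k \<theta>"]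
          by (simp add: algebra_simps power_mult_distrib[of \<epsilon>])
      qed (intro continuous_intros uc kc)+
      also have "\<dots> = V + (?N * \<epsilon> * sphere_int (\<lambda>\<theta>. u \<theta> ^ ?N * k \<theta>) + c * \<epsilon>\<^sup>2 * sphere_int (\<lambda>\<theta>. u \<theta> ^ ?N * (k \<theta>)\<^sup>2))"
        by (simp add: sphere_int_add sphere_int_cmult V_def continuous_intros uc kc)
      finally have "v ^ ?N + ?N * (\<epsilon> * w) * v ^ (?N - 1)
          \<le> V + (?N * \<epsilon> * sphere_int (\<lambda>\<theta>. u \<theta> ^ ?N * k \<theta>) + c * \<epsilon>\<^sup>2 * sphere_int (\<lambda>\<theta>. u \<theta> ^ ?N * (k \<theta>)\<^sup>2))"
        using power_add_ge_linear[of v "\<epsilon> * w" ?N] v0 w0 \<epsilon>1 by simp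
      moreover have "v ^ ?N = V"
        using V0 by (simp add: v_def)
      \<comment> \<open>The terms of order 0 agree, both being V; the rest is divided by N
        \<epsilon>.\<close>
      ultimately have "(?N * \<epsilon>) * (w * v ^ (?N - 1))
          \<le> (?N * \<epsilon>) * (sphere_int (\<lambda>\<theta>. u \<theta> ^ ?N * k \<theta>) + \<epsilon> * (c / ?N * sphere_int (\<lambda>\<theta>. u \<theta> ^ ?N * (k \<theta>)\<^sup>2)))"
        by (simp add: algebra_simps power2_eq_square)
      then show ?thesis
        using \<epsilon>1 by (simp add: mult_le_cancel_left_pos)
    qed
    have "w * v ^ (?N - 1) \<le> sphere_int (\<lambda>\<theta>. u \<theta> ^ ?N * k \<theta>)"
    proof (rule tendsto_le[of "at_right (0::real)"])
      show "((\<lambda>\<epsilon>. sphere_int (\<lambda>\<theta>. u \<theta> ^ ?N * k \<theta>) + \<epsilon> * (c / ?N * sphere_int (\<lambda>\<theta>. u \<theta> ^ ?N * (k \<theta>)\<^sup>2)))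
          \<longlongrightarrow> sphere_int (\<lambda>\<theta>. u \<theta> ^ ?N * k \<theta>)) (at_right 0)"
        by (rule tendsto_eq_intros refl tendsto_ident_at)+ simp
      show "\<forall>\<^sub>F \<epsilon> in at_right 0. w * v ^ (?N - 1) \<le> sphere_int (\<lambda>\<theta>. u \<theta> ^ ?N * k \<theta>)
          + \<epsilon> * (c / ?N * sphere_int (\<lambda>\<theta>. u \<theta> ^ ?N * (k \<theta>)\<^sup>2))"
        using \<epsilon>0(1) key by (auto simp: eventually_at_right_field intro!: exI[of _ "min \<epsilon>0 1"])
    qed auto
    also have "\<dots> = sphere_int (\<lambda>\<theta>. u \<theta> ^ ?N * q \<theta>) + \<eta> * V"
    proof -
      have "sphere_int (\<lambda>\<theta>. u \<theta> ^ ?N * k \<theta>) = sphere_int (\<lambda>\<theta>. u \<theta> ^ ?N * q \<theta> + \<eta> * u \<theta> ^ ?N)"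
        by (rule sphere_int_cong) (simp add: k_def algebra_simps)
      then show ?thesis
        by (simp add: sphere_int_add sphere_int_cmult V_def continuous_intros uc qc)
    qed
    finally show ?thesis .
  qed
  have "w * v ^ (?N - 1) \<le> sphere_int (\<lambda>\<theta>. u \<theta> ^ ?N * q \<theta>)"
  proof (rule tendsto_le[of "at_right (0::real)"])
    show "((\<lambda>\<eta>. sphere_int (\<lambda>\<theta>. u \<theta> ^ ?N * q \<theta>) + \<eta> * V) \<longlongrightarrow> sphere_int (\<lambda>\<theta>. u \<theta> ^ ?N * q \<theta>)) (at_right 0)"
      by (rule tendsto_eq_intros refl tendsto_ident_at)+ simp
    show "\<forall>\<^sub>F \<eta> in at_right 0. w * v ^ (?N - 1) \<le> sphere_int (\<lambda>\<theta>. u \<theta> ^ ?N * q \<theta>) + \<eta> * V"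
      using claim by (auto simp: eventually_at_right_field intro!: exI[of _ 1])
  qed auto
  also have "\<dots> = sphere_int (\<lambda>\<theta>. u \<theta> ^ (?N - 2) * sqrt ((u \<theta>)\<^sup>2 + (norm (Du \<theta>))\<^sup>2))"
  proof (rule sphere_int_cong)
    fix \<theta> assume \<theta>: "\<theta> \<in> ?S"
    have "u \<theta> ^ ?N = u \<theta> ^ (?N - 2) * (u \<theta>)\<^sup>2"
      using dim by (metis le_add_diff_inverse2 power_add)
    then show "u \<theta> ^ ?N * q \<theta> = u \<theta> ^ (?N - 2) * sqrt ((u \<theta>)\<^sup>2 + (norm (Du \<theta>))\<^sup>2)"
      using u0[OF \<theta>] by (simp add: q_def)
  qed
  finally show ?thesis
    by (simp add: w_def v_def V_def)
qed

text \<open>For non-negative \<open>u\<close> the positive case is applied to u + \<delta>, which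
  has the same gradient. The left side only grows, and the area integral grows by at most
  \<open>e\<close> when \<delta> is small, by uniform continuity of the density on [0,1] x
  S.\<close>

lemma isoperimetric_star:
  fixes u :: "'a::euclidean_space \<Rightarrow> real"
  assumes dim: "2 \<le> DIM('a)"
    and der: "\<And>x. x \<noteq> 0 \<Longrightarrow> ((\<lambda>y. u (sgn y)) has_derivative (\<lambda>h. Du x \<bullet> h)) (at x)"
    and Du: "continuous_on (- {0}) Du" and u: "\<And>\<theta>. \<theta> \<in> sphere 0 1 \<Longrightarrow> 0 \<le> u \<theta>"
    and uc: "continuous_on (sphere 0 1) u"
  shows "root DIM('a) (omega TYPE('a)) * root DIM('a) (sphere_int (\<lambda>\<theta>. u \<theta> ^ DIM('a))) ^ (DIM('a) - 1)
    \<le> sphere_int (\<lambda>\<theta>. u \<theta> ^ (DIM('a) - 2) * sqrt ((u \<theta>)\<^sup>2 + (norm (Du \<theta>))\<^sup>2))"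
    (is "?l \<le> sphere_int ?H")
proof (rule field_le_epsilon)
  let ?S = "sphere (0::'a) 1"
  fix e :: real assume e: "0 < e"
  define e' where "e' = e / omega TYPE('a)"
  have e': "0 < e'"
    using e omega_pos[where 'a = 'a] by (simp add: e'_def)
  have Du': "continuous_on ?S Du"
    by (rule continuous_on_subset[OF Du]) auto
  define F where "F z = (u (snd z) + fst z) ^ (DIM('a) - 2) * sqrt ((u (snd z) + fst z)\<^sup>2 + (norm (Du (snd z)))\<^sup>2)"
    for z :: "real \<times> 'a"
  have "continuous_on ({0..1} \<times> ?S) F"
    unfolding F_def by (intro continuous_intros continuous_on_compose2[OF uc] continuous_on_compose2[OF Du']) auto
  then have "uniformly_continuous_on ({0..1} \<times> ?S) F"
    by (intro compact_uniformly_continuous compact_Times) auto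
  then obtain d where d: "0 < d" "\<And>z z'. z \<in> {0..1} \<times> ?S \<Longrightarrow> z' \<in> {0..1} \<times> ?S \<Longrightarrow> dist z' z < d \<Longrightarrow> dist (F z') (F z) < e'"
    unfolding uniformly_continuous_on_def using e' by metis
  define \<delta> where "\<delta> = min (d / 2) 1"
  have \<delta>: "0 < \<delta>" "\<delta> < d" "\<delta> \<le> 1"
    using d(1) by (auto simp: \<delta>_def)
  have c1: "continuous_on ?S (\<lambda>\<theta>. (u \<theta> + \<delta>) ^ k)" for k
    by (intro continuous_intros uc)
  have Hc: "continuous_on ?S (\<lambda>\<theta>. (u \<theta> + \<delta>) ^ (DIM('a) - 2) * sqrt ((u \<theta> + \<delta>)\<^sup>2 + (norm (Du \<theta>))\<^sup>2))"
      "continuous_on ?S ?H"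
    by (intro continuous_intros uc Du')+
  have "sphere_int (\<lambda>\<theta>. u \<theta> ^ DIM('a)) \<le> sphere_int (\<lambda>\<theta>. (u \<theta> + \<delta>) ^ DIM('a))"
    by (rule sphere_int_mono) (use u \<delta> in \<open>auto intro!: continuous_intros uc power_mono\<close>)
  moreover have "0 \<le> sphere_int (\<lambda>\<theta>. u \<theta> ^ DIM('a))"
    by (rule sphere_int_nonneg) (use u in \<open>auto intro!: continuous_intros uc\<close>)
  ultimately have "?l \<le> root DIM('a) (omega TYPE('a)) * root DIM('a) (sphere_int (\<lambda>\<theta>. (u \<theta> + \<delta>) ^ DIM('a))) ^ (DIM('a) - 1)"
    using omega_pos[where 'a = 'a] by (intro mult_left_mono power_mono) auto
  also have "\<dots> \<le> sphere_int (\<lambda>\<theta>. (u \<theta> + \<delta>) ^ (DIM('a) - 2) * sqrt ((u \<theta> + \<delta>)\<^sup>2 + (norm (Du \<theta>))\<^sup>2))"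
  proof (rule isoperimetric_star_pos[OF dim _ Du])
    show "((\<lambda>y. u (sgn y) + \<delta>) has_derivative (\<lambda>h. Du x \<bullet> h)) (at x)" if "x \<noteq> 0" for x
      using has_derivative_add[OF der[OF that] has_derivative_const[of \<delta>]] by simp
    show "0 < u \<theta> + \<delta>" if "\<theta> \<in> ?S" for \<theta>
      using u[OF that] \<delta> by simp
  qed (intro continuous_intros uc)
  also have "\<dots> \<le> sphere_int (\<lambda>\<theta>. ?H \<theta> + e')"
  proof (rule sphere_int_mono)
    fix \<theta> assume \<theta>: "\<theta> \<in> ?S"
    have "dist (F (\<delta>, \<theta>)) (F (0, \<theta>)) < e'"
      using \<theta> \<delta> by (intro d(2)) (auto simp: dist_Pair_Pair)
    then show "(u \<theta> + \<delta>) ^ (DIM('a) - 2) * sqrt ((u \<theta> + \<delta>)\<^sup>2 + (norm (Du \<theta>))\<^sup>2) \<le> ?H \<theta> + e'"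
      by (simp add: F_def dist_real_def abs_less_iff)
  qed (intro Hc continuous_intros)+
  also have "\<dots> = sphere_int ?H + e"
    using omega_pos[where 'a = 'a] by (simp add: sphere_int_add Hc sphere_int_const e'_def)
  finally show "?l \<le> sphere_int ?H + e" .
qed

section \<open>The warping function\<close>

locale ads_schwarzschild =
  fixes n :: nat and m a :: real and lam :: "real \<Rightarrow> real"
  assumes n: "1 \<le> n" and m: "0 \<le> m"
    and lam_ode: "\<And>s. a \<le> s \<Longrightarrow> (lam has_real_derivative lam_d m n lam s) (at s within {a..})"
    and lam_a: "lam a = m powr (1 / (real n + 1))"
begin

definition u0 :: real where "u0 = m powr (1 / (real n + 1))"

text \<open>The function \<open>sqrt (\<lambda>'\<^sup>2 - 1)\<close> of the variable \<open>t = \<lambda>\<close>.\<close>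
definition h :: "real \<Rightarrow> real" where "h t = sqrt (t\<^sup>2 - m * t powr (1 - real n))"

definition G :: "real \<Rightarrow> real" where "G t = t ^ n * h t"

text \<open>omega F(t) is the right side of the equation for eta, see \<open>integral_Lam\<close>.
  The form h(s) s^(n-1), instead of (h(s) / s) s^n, avoids a division at s = 0, a point that occurs
  for m = 0.\<close>

definition F :: "real \<Rightarrow> real" where "F t = integral {u0..t} (\<lambda>s. h s * s ^ (n - 1))"

lemma u0_nonneg: "0 \<le> u0"
  by (simp add: u0_def)

lemma u0_power: "u0 ^ (n + 1) = m"
proof (cases "m = 0")
  case False
  then have "0 < u0" using m by (simp add: u0_def)
  then have "u0 ^ (n + 1) = u0 powr real (n + 1)"
    by (rule powr_realpow[symmetric])
  also have "\<dots> = m"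
    using m by (simp add: u0_def powr_powr add.commute)
  finally show ?thesis .
next
  case True
  have "u0 = 0"
    unfolding u0_def using True by simp
  then show ?thesis
    using True n by simp
qed

lemma u0_eq_0_iff: "u0 = 0 \<longleftrightarrow> m = 0"
  by (simp add: u0_def)

lemma power_ge_m: "u0 \<le> t \<Longrightarrow> m \<le> t ^ (n + 1)"
  using power_mono[of u0 t "n + 1"] u0_nonneg u0_power by simp

text \<open>Makes the slope h(t) / t = sqrt(1 - m / t^(n+1)) visible, from which sign and
  monotonicity are read off.\<close>

lemma h_eq_pos:
  assumes "0 < t"
  shows "h t = t * sqrt (1 - m / t ^ (n + 1))"
proof -
  have "t powr (1 - real n) = t\<^sup>2 / t ^ (n + 1)"
    using assms by (simp add: powr_diff powr_realpow power2_eq_square)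
  then have "t\<^sup>2 - m * t powr (1 - real n) = t\<^sup>2 * (1 - m / t ^ (n + 1))"
    by (simp add: right_diff_distrib)
  then show ?thesis
    using assms by (simp add: h_def real_sqrt_mult)
qed

text \<open>\<open>0 powr x = 0\<close> by convention, so this holds for all m and n, in particular
  for n = 1, where \<open>t powr 0 = 1\<close> for t > 0.\<close>

lemma h_0: "h 0 = 0"
  by (simp add: h_def)

lemma ge_u0_cases:
  assumes "u0 \<le> t"
  obtains "0 < t" | "t = 0" "m = 0" "u0 = 0"
proof (cases "0 < t")
  case False
  then have "t = 0" "u0 = 0"
    using assms u0_nonneg by auto
  then show ?thesis
    using that(2) u0_eq_0_iff by blast
qed

lemma h_nonneg:
  assumes "u0 \<le> t"
  shows "0 \<le> h t"
  using assms
proof (cases rule: ge_u0_cases)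
  case 1
  have "m / t ^ (n + 1) \<le> 1"
    using power_ge_m[OF assms] 1 by (simp add: divide_le_eq)
  then show ?thesis
    using 1 by (simp add: h_eq_pos)
next
  case 2
  show ?thesis
    unfolding 2(1) by (simp add: h_0)
qed

text \<open>The real \<open>sqrt\<close> is odd, so \<open>0 \<le> h t\<close> already says that the
  radicand is non-negative.\<close>

lemma h_sq:
  assumes "u0 \<le> t"
  shows "(h t)\<^sup>2 = t\<^sup>2 - m * t powr (1 - real n)"
  using h_nonneg[OF assms] unfolding h_def by (simp add: real_sqrt_ge_0_iff)

text \<open>The radicand is a polynomial, which is convenient for differentiation.\<close>

lemma G_eq:
  assumes "u0 \<le> t"
  shows "G t = sqrt (t ^ (n + 1) * (t ^ (n + 1) - m))"
  using assms
proof (cases rule: ge_u0_cases)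
  case 1
  have "G t = t ^ (n + 1) * sqrt (1 - m / t ^ (n + 1))"
    using 1 by (simp add: G_def h_eq_pos)
  also have "\<dots> = sqrt ((t ^ (n + 1))\<^sup>2 * (1 - m / t ^ (n + 1)))"
    using 1 by (simp add: real_sqrt_mult)
  also have "(t ^ (n + 1))\<^sup>2 * (1 - m / t ^ (n + 1)) = t ^ (n + 1) * (t ^ (n + 1) - m)"
    using 1 by (simp add: power2_eq_square right_diff_distrib)
  finally show ?thesis .
next
  case 2
  show ?thesis
    unfolding 2(1) by (simp add: G_def h_0)
qed

lemma G_nonneg: "u0 \<le> t \<Longrightarrow> 0 \<le> G t"
  using u0_nonneg h_nonneg by (simp add: G_def)

lemma G_u0: "G u0 = 0"
  using G_eq[of u0] u0_power by simp

text \<open>\<open>t powr (1 - real n)\<close> jumps or blows up at 0. For m = 0 that term drops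
  out, and for m > 0 the domain starts at u0 > 0.\<close>

lemma continuous_on_h: "continuous_on {u0..} h"
proof (cases "m = 0")
  case True
  then show ?thesis
    unfolding h_def by (simp, intro continuous_intros)
next
  case False
  then have "0 < u0"
    using u0_nonneg u0_eq_0_iff by force
  then show ?thesis
    unfolding h_def by (intro continuous_intros) auto
qed

text \<open>Up to the factor n + 1 the slope is the derivative of F with respect to t^(n+1); its
  monotonicity is the convexity behind Jensen. At s = 0 the quotient is 0 by convention.\<close>

lemma slope_mono:
  assumes s: "u0 \<le> s" and st: "s \<le> t"
  shows "h s / s \<le> h t / t"
  using s
proof (cases rule: ge_u0_cases)
  case 1
  then have t: "0 < t" using st by simp
  have "s ^ (n + 1) \<le> t ^ (n + 1)"
    using 1 st by (intro power_mono) auto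
  then have "m / t ^ (n + 1) \<le> m / s ^ (n + 1)"
    using 1 t m by (intro divide_left_mono) auto
  then show ?thesis
    using 1 t by (simp add: h_eq_pos)
next
  case 2
  have "0 \<le> h t / t"
    using h_nonneg[of t] s st u0_nonneg by simp
  then show ?thesis
    unfolding 2(1) by simp
qed

lemma h_pos:
  assumes "u0 < t"
  shows "0 < h t"
proof -
  have t: "0 < t"
    using assms u0_nonneg by simp
  have "m < t ^ (n + 1)"
    using power_strict_mono[of u0 t "n + 1"] assms u0_nonneg u0_power by simp
  then show ?thesis
    using t by (simp add: h_eq_pos)
qed

text \<open>h(t) is t times the slope. Strictness comes from the factor t, since for m = 0 the slope
  is constant on t > 0.\<close>

lemma h_strict_mono:
  assumes s: "u0 \<le> s" and st: "s < t"
  shows "h s < h t"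
proof -
  have t: "0 < t" "u0 < t"
    using s st u0_nonneg by auto
  show ?thesis
  proof (cases "s = 0")
    case True
    then show ?thesis
      using h_pos[OF t(2)] h_0 by simp
  next
    case False
    then have s0: "0 < s"
      using s u0_nonneg by simp
    have "h s = s * (h s / s)"
      using s0 by simp
    also have "\<dots> \<le> s * (h t / t)"
      using slope_mono[OF s] st s0 by (intro mult_left_mono) auto
    also have "\<dots> < t * (h t / t)"
      using h_pos[OF t(2)] t st by (intro mult_strict_right_mono) auto
    finally show ?thesis
      using t by simp
  qed
qed

section \<open>The solution lambda of the differential equation\<close>

lemma lam_d_eq: "lam_d m n lam s = sqrt (1 + ((lam s)\<^sup>2 - m * lam s powr (1 - real n)))"
  by (simp add: lam_d_def algebra_simps)

lemma lam_d_eq_h: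
  assumes "u0 \<le> lam s"
  shows "lam_d m n lam s = sqrt (1 + (h (lam s))\<^sup>2)"
  by (simp add: lam_d_eq h_sq[OF assms])

lemma lam_a': "lam a = u0"
  by (simp add: lam_a u0_def)

lemma continuous_on_lam: "continuous_on {a..} lam"
  using lam_ode by (intro DERIV_continuous_on) auto

text \<open>At a last point where \<open>\<lambda> \<ge> u0\<close> the derivative would be positive, so \<open>\<lambda>\<close> cannot fall below \<open>u0\<close>.\<close>
lemma lam_ge_u0:
  assumes s: "a \<le> s"
  shows "u0 \<le> lam s"
proof (rule ccontr)
  assume less: "\<not> u0 \<le> lam s"
  let ?X = "{a..s} \<inter> lam -` {u0..}"
  have cont: "continuous_on {a..s} lam"
    by (rule continuous_on_subset[OF continuous_on_lam]) auto
  have "closed ?X"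
    by (rule continuous_closed_preimage[OF cont]) auto
  moreover have "bounded ?X"
    by (rule bounded_subset[of "{a..s}"]) auto
  ultimately have "compact ?X"
    by (simp add: compact_eq_bounded_closed)
  moreover have "a \<in> ?X"
    using s lam_a' by auto
  ultimately obtain t where t: "t \<in> ?X" "\<And>x. x \<in> ?X \<Longrightarrow> x \<le> t"
    using compact_attains_sup[of ?X] by blast
  have ts: "t < s" "a \<le> t"
    using t(1) less by (auto simp: less_le)
  have ut: "u0 \<le> lam t"
    using t(1) by simp
  have "(lam has_real_derivative lam_d m n lam t) (at t within {a..})"
    using lam_ode ts by simp
  moreover have "0 < lam_d m n lam t"
    using lam_d_eq_h[OF ut] by (simp add: add_pos_nonneg)
  ultimately obtain d where d: "0 < d" "\<And>e. 0 < e \<Longrightarrow> t + e \<in> {a..} \<Longrightarrow> e < d \<Longrightarrow> lam t < lam (t + e)"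
    using has_real_derivative_pos_inc_right by metis
  define e where "e = min (d / 2) (s - t)"
  have e: "0 < e" "e < d" "t + e \<le> s"
    using d(1) ts by (auto simp: e_def)
  then have "lam t < lam (t + e)"
    using d(2)[of e] ts by simp
  then have "t + e \<in> ?X"
    using e ts ut by auto
  then show False
    using t(2)[of "t + e"] e by simp
qed

text \<open>lambda' = sqrt(1 + h^2) \<ge> 1. This one bound yields injectivity, unboundedness and u0
  < lambda(s) for s > a.\<close>

lemma lam_increase:
  assumes "a \<le> s" "s \<le> t"
  shows "t - s \<le> lam t - lam s"
proof (cases "s = t")
  case False
  then have "s < t" using assms by simp
  then have "\<exists>x\<in>{s<..<t}. lam t - lam s = lam_d m n lam x * (t - s)"
  proof (rule mvt_simple)
    fix x assume "s \<le> x" "x \<le> t"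
    then have "(lam has_real_derivative lam_d m n lam x) (at x within {s..t})"
      using assms by (intro DERIV_subset[OF lam_ode]) auto
    then show "(lam has_derivative (\<lambda>y. lam_d m n lam x * y)) (at x within {s..t})"
      by (simp add: has_field_derivative_def)
  qed
  then obtain x where x: "s < x" "lam t - lam s = lam_d m n lam x * (t - s)"
    by auto
  have "1 \<le> lam_d m n lam x"
    using lam_d_eq_h[OF lam_ge_u0, of x] x assms by simp
  then have "1 * (t - s) \<le> lam_d m n lam x * (t - s)"
    using assms by (intro mult_right_mono) auto
  then show ?thesis
    using x by simp
qed simp

lemma lam_inj: "inj_on lam {a..}"
proof (rule linorder_inj_onI')
  fix i j assume "i \<in> {a..}" "j \<in> {a..}" "i < j"
  then show "lam i \<noteq> lam j"
    using lam_increase[of i j] by auto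
qed

lemma lam_surj:
  assumes t: "u0 \<le> t"
  obtains s where "a \<le> s" "lam s = t"
proof -
  \<comment> \<open>Slope at least 1 brings lambda from u0 up to t within a distance t - u0.\<close>
  let ?b = "a + (t - u0)"
  have "t \<le> lam ?b"
    using lam_increase[of a ?b] lam_a' t by simp
  moreover have "continuous_on {a..?b} lam"
    by (rule continuous_on_subset[OF continuous_on_lam]) auto
  ultimately obtain s where "a \<le> s" "lam s = t"
    using IVT'[of lam a t ?b] lam_a' t by auto
  then show ?thesis by (rule that)
qed

text \<open>lambda' depends on r only through lambda, so the inverse function in \<open>Psi\<close>
  disappears and Psi^2 - 1 = h^2.\<close>

lemma Lam_eq:
  assumes t: "u0 \<le> t"
  shows "Lam m n lam a t = h t / t"
proof -
  obtain s where s: "a \<le> s" "lam s = t"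
    using lam_surj[OF t] .
  then have "the_inv_into {a..} lam t = s"
    using the_inv_into_f_f[OF lam_inj, of s] by simp
  then have "Psi m n lam a t = sqrt (1 + (h t)\<^sup>2)"
    using lam_d_eq_h[of s] s t by (simp add: Psi_def)
  then show ?thesis
    using h_nonneg[OF t] by (simp add: Lam_def)
qed

section \<open>The primitive F and its convexity\<close>

lemma continuous_on_F_integrand: "continuous_on {u0..} (\<lambda>s. h s * s ^ (n - 1))"
  by (intro continuous_intros continuous_on_h)

lemma F_deriv_within:
  assumes "u0 \<le> t" "t \<le> b"
  shows "(F has_real_derivative h t * t ^ (n - 1)) (at t within {u0..b})"
  unfolding F_def using assms
  by (intro integral_has_real_derivative continuous_on_subset[OF continuous_on_F_integrand]) auto

lemma F_deriv:
  assumes "u0 < t"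
  shows "(F has_real_derivative h t * t ^ (n - 1)) (at t)"
proof -
  have "(F has_real_derivative h t * t ^ (n - 1)) (at t within {u0..t + 1})"
    using assms by (intro F_deriv_within) auto
  moreover have "at t within {u0..t + 1} = at t"
    using assms by (intro at_within_interior) auto
  ultimately show ?thesis
    by simp
qed

lemma F_u0: "F u0 = 0"
  by (simp add: F_def)

lemma integral_Lam:
  "integral {u0..t} (\<lambda>s. Lam m n lam a s * s ^ n) = F t"
  unfolding F_def
proof (rule integral_cong)
  fix s assume "s \<in> {u0..t}"
  then have s: "u0 \<le> s" by simp
  have "s ^ n = s * s ^ (n - 1)"
    using n by (simp add: power_eq_if)
  \<comment> \<open>At s = 0 both sides vanish; for the right one this is h(0) = 0 when n = 1, where
    s^(n-1) = 1.\<close>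
  then show "Lam m n lam a s * s ^ n = h s * s ^ (n - 1)"
    using Lam_eq[OF s] h_0 by simp
qed

lemma DERIV_power_div:
  assumes "(f has_real_derivative D) (at x within S)"
  shows "((\<lambda>x. f x ^ (n + 1) / (real n + 1)) has_real_derivative D * f x ^ n) (at x within S)"
proof -
  have "((\<lambda>x. f x ^ (n + 1) / (real n + 1)) has_real_derivative real (n + 1) * (D * f x ^ n) / (real n + 1)) (at x within S)"
    using DERIV_cdivide[OF DERIV_power[OF assms, of "n + 1"]] by simp
  moreover have "real (n + 1) * (D * f x ^ n) / (real n + 1) = D * f x ^ n"
    by (simp add: add.commute)
  ultimately show ?thesis
    by metis
qed

lemma integral_power:
  assumes "u0 \<le> t"
  shows "integral {u0..t} (\<lambda>s. s ^ n) = (t ^ (n + 1) - m) / (real n + 1)"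
proof -
  have "((\<lambda>s. s ^ n) has_integral t ^ (n + 1) / (real n + 1) - u0 ^ (n + 1) / (real n + 1)) {u0..t}"
  proof (rule fundamental_theorem_of_calculus[OF assms])
    fix s
    show "((\<lambda>s. s ^ (n + 1) / (real n + 1)) has_vector_derivative s ^ n) (at s within {u0..t})"
      using DERIV_power_div[OF DERIV_ident, of s "{u0..t}"]
      by (simp only: has_real_derivative_iff_has_vector_derivative mult_1)
  qed
  then show ?thesis
    by (simp only: integral_unique u0_power diff_divide_distrib)
qed

text \<open>The tangent line inequality for the convex function \<open>x \<mapsto> F (x powr (1 / (n + 1)))\<close>.\<close>
lemma F_tangent:
  assumes u: "u0 \<le> u" and U: "u0 \<le> U"
  shows "F U + h U / U / (real n + 1) * (u ^ (n + 1) - U ^ (n + 1)) \<le> F u"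
proof -
  \<comment> \<open>\<open>Q\<close> is F minus the linear function of x^(n+1) with the slope of the
    tangent at \<open>U\<close>. Its derivative x^n (h(x) / x - h(U) / U) is non-positive below
    \<open>U\<close> and non-negative above, so \<open>Q\<close> is minimal at
    \<open>U\<close>.\<close>
  define Q where "Q x = F x - h U / U * (x ^ (n + 1) / (real n + 1))" for x
  have Q': "(Q has_derivative (\<lambda>y. (x ^ n * (h x / x - h U / U)) * y)) (at x within {s..t})"
    if "u0 \<le> s" "s \<le> x" "x \<le> t" for s t x
  proof -
    have "(F has_real_derivative h x * x ^ (n - 1)) (at x within {s..t})"
      using that by (intro DERIV_subset[OF F_deriv_within[of x t]]) auto
    then have "(Q has_real_derivative h x * x ^ (n - 1) - h U / U * (1 * x ^ n)) (at x within {s..t})"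
      unfolding Q_def by (intro DERIV_diff DERIV_cmult DERIV_power_div DERIV_ident)
    moreover have "h x * x ^ (n - 1) - h U / U * (1 * x ^ n) = x ^ n * (h x / x - h U / U)"
    proof -
      have "h x * x ^ (n - 1) = x ^ n * (h x / x)"
        using n h_0 by (cases "x = 0") (auto simp: power_eq_if)
      then show ?thesis
        by (simp add: right_diff_distrib)
    qed
    ultimately show ?thesis
      by (simp add: has_field_derivative_def)
  qed
  have "Q U \<le> Q u"
  proof (cases u U rule: linorder_cases)
    case less
    then obtain x where x: "x \<in> {u<..<U}" "Q U - Q u = (x ^ n * (h x / x - h U / U)) * (U - u)"
      using mvt_simple[OF less, of Q, OF Q'[OF u]] by blast
    have "x ^ n * (h x / x - h U / U) \<le> 0"
      using x u u0_nonneg slope_mono[of x U] by (intro mult_nonneg_nonpos) auto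
    then have "Q U - Q u \<le> 0"
      unfolding x(2) by (rule mult_nonpos_nonneg) (use less in simp)
    then show ?thesis by simp
  next
    case greater
    then obtain x where x: "x \<in> {U<..<u}" "Q u - Q U = (x ^ n * (h x / x - h U / U)) * (u - U)"
      using mvt_simple[OF greater, of Q, OF Q'[OF U]] by blast
    have "0 \<le> x ^ n * (h x / x - h U / U)"
      using x U u0_nonneg slope_mono[of U x] by (intro mult_nonneg_nonneg) auto
    then have "0 \<le> Q u - Q U"
      unfolding x(2) by (rule mult_nonneg_nonneg) (use greater in simp)
    then show ?thesis by simp
  qed simp
  moreover have "K / (real n + 1) * (x - y) = K * (x / (real n + 1)) - K * (y / (real n + 1))" for K x y :: real
    by (simp add: right_diff_distrib diff_divide_distrib)
  ultimately show ?thesis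
    unfolding Q_def by (simp only:)
qed

lemma integral_lam_d_power:
  assumes r: "a \<le> r"
  shows "integral {a..r} (\<lambda>s. lam_d m n lam s * lam s ^ n) = (lam r ^ (n + 1) - m) / (real n + 1)"
proof -
  have "((\<lambda>s. lam_d m n lam s * lam s ^ n) has_integral lam r ^ (n + 1) / (real n + 1) - lam a ^ (n + 1) / (real n + 1)) {a..r}"
  proof (intro fundamental_theorem_of_calculus r)
    fix s assume "s \<in> {a..r}"
    then have "(lam has_real_derivative lam_d m n lam s) (at s within {a..r})"
      by (intro DERIV_subset[OF lam_ode]) auto
    then have "((\<lambda>s. lam s ^ (n + 1) / (real n + 1)) has_real_derivative lam_d m n lam s * lam s ^ n) (at s within {a..r})"
      by (rule DERIV_power_div)
    then show "((\<lambda>s. lam s ^ (n + 1) / (real n + 1)) has_vector_derivative lam_d m n lam s * lam s ^ n) (at s within {a..r})"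
      by (simp only: has_real_derivative_iff_has_vector_derivative)
  qed
  then show ?thesis
    by (simp only: integral_unique lam_a' u0_power diff_divide_distrib)
qed

section \<open>The second domain integral\<close>

text \<open>The first summand is (n + 1) F'. The second, after the substitution t = lambda(s), is a
  multiple of the integrand lambda' / h(lambda) of the second domain integral.\<close>

lemma G_deriv:
  assumes t: "u0 < t"
  shows "(G has_real_derivative (real n + 1) * (h t * t ^ (n - 1) + m / 2 / h t)) (at t)"
proof -
  have t0: "0 < t" using t u0_nonneg by simp
  let ?p = "t ^ (n + 1)"
  have mp: "m < ?p"
    using power_strict_mono[of u0 t "n + 1"] t u0_nonneg u0_power by simp
  have P: "0 < ?p * (?p - m)"
    using mp t0 by simp
  have "((\<lambda>t. sqrt (t ^ (n + 1) * (t ^ (n + 1) - m))) has_real_derivative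
      ((real n + 1) * t ^ n * (2 * ?p - m)) / (2 * sqrt (?p * (?p - m)))) (at t)"
  proof -
    have p: "((\<lambda>t. t ^ (n + 1)) has_real_derivative (real n + 1) * t ^ n) (at t)"
      using DERIV_pow[of "n + 1" t] by (simp add: add.commute)
    have "((\<lambda>t. t ^ (n + 1) * (t ^ (n + 1) - m)) has_real_derivative
        (real n + 1) * t ^ n * (?p - m) + (real n + 1) * t ^ n * ?p) (at t)"
      using DERIV_mult[OF p DERIV_diff[OF p DERIV_const[of m]]] by simp
    from DERIV_chain2[OF DERIV_real_sqrt[OF P] this]
    show ?thesis
      by (rule DERIV_cong) (simp add: field_simps)
  qed
  moreover have "sqrt (?p * (?p - m)) = G t"
    using G_eq t by simp
  moreover have "((real n + 1) * t ^ n * (2 * ?p - m)) / (2 * G t) = (real n + 1) * (h t * t ^ (n - 1) + m / 2 / h t)"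
  proof -
    have hp: "0 < h t" by (rule h_pos[OF t])
    \<comment> \<open>\<open>A\<close> and \<open>B\<close> combine to h^2 t^(n-1) = t^(n+1) - m,
      which turns the numerator 2 t^(n+1) - m into 2 h^2 t^(n-1) + m.\<close>
    have A: "(h t)\<^sup>2 * ?p = t\<^sup>2 * (?p - m)"
      using h_eq_pos[OF t0] mp t0 by (simp add: power_mult_distrib field_simps)
    have B: "?p = t\<^sup>2 * t ^ (n - 1)"
      using n by (simp flip: power_add)
    have "t\<^sup>2 * ((h t)\<^sup>2 * t ^ (n - 1)) = (h t)\<^sup>2 * ?p"
      unfolding B by (simp only: ac_simps)
    also note A
    finally have "(h t)\<^sup>2 * t ^ (n - 1) = ?p - m"
      using t0 by simp
    then have "(2 * ?p - m) = 2 * ((h t)\<^sup>2 * t ^ (n - 1)) + m"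
      by simp
    then show ?thesis
      using hp t0 unfolding G_def by (simp add: field_simps power2_eq_square)
  qed
  ultimately have *: "((\<lambda>t. sqrt (t ^ (n + 1) * (t ^ (n + 1) - m))) has_real_derivative
      (real n + 1) * (h t * t ^ (n - 1) + m / 2 / h t)) (at t)"
    by simp
  show ?thesis
    by (rule has_field_derivative_transform_within_open[OF *, of "{u0<..}"]) (use t G_eq in auto)
qed

lemma continuous_on_G: "continuous_on {u0..} G"
  unfolding G_def by (intro continuous_intros continuous_on_h)

lemma continuous_on_F: "continuous_on {u0..b} F"
  by (rule DERIV_continuous_on) (use F_deriv_within in auto)

text \<open>By \<open>G_deriv\<close> the integrand is, up to a constant, the derivative of G - (n +
  1) F along lambda; both G and F vanish at u0.\<close>

lemma integral_second:
  assumes r: "a \<le> r"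
  shows "m * (real n + 1) / 2 * integral {a..r}
      (\<lambda>s. lam_d m n lam s / (lam s ^ n * sqrt ((lam_d m n lam s)\<^sup>2 - 1)) * lam s ^ n)
    = G (lam r) - (real n + 1) * F (lam r)"
proof (cases "m = 0")
  \<comment> \<open>For m = 0 the integrand behaves like 1 / (s - a) near \<open>a\<close> and is
    not integrable for r > a. The factor m makes the left side 0 all the same, and it remains to see
    that G = (n + 1) F.\<close>
  case True
  have "F t = t ^ (n + 1) / (real n + 1)" if t: "u0 \<le> t" for t
  proof -
    have "F t = integral {u0..t} (\<lambda>s. s ^ n)"
      unfolding F_def
    proof (rule integral_cong)
      fix s assume "s \<in> {u0..t}"
      then have "0 \<le> s" using u0_nonneg by simp
      then have "h s = s"
        using True unfolding h_def by simp
      moreover have "s ^ n = s * s ^ (n - 1)"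
        using n by (simp add: power_eq_if)
      ultimately show "h s * s ^ (n - 1) = s ^ n"
        by simp
    qed
    then show ?thesis
      using integral_power[OF t] True by simp
  qed
  moreover have "G t = t ^ (n + 1)" if t: "u0 \<le> t" for t
    using t u0_nonneg True unfolding G_def h_def by simp
  ultimately show ?thesis
    using lam_ge_u0[OF r] True by simp
next
  case False
  then have mp: "0 < m" using m by simp
  define c where "c = m * (real n + 1) / 2"
  have c: "0 < c"
    using mp by (simp add: c_def)
  define \<Phi> where "\<Phi> s = (G (lam s) - (real n + 1) * F (lam s)) / c" for s
  have "((\<lambda>s. lam_d m n lam s / (lam s ^ n * sqrt ((lam_d m n lam s)\<^sup>2 - 1)) * lam s ^ n) has_integral \<Phi> r - \<Phi> a) {a..r}"
  \<comment> \<open>The derivative lambda' / h(lambda) of \<Phi> is unbounded near \<open>a\<close>,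
    as h(u0) = 0; at the endpoints only continuity is asked for.\<close>
  proof (rule fundamental_theorem_of_calculus_interior[OF r])
    have cl: "continuous_on {a..r} lam"
      by (rule continuous_on_subset[OF continuous_on_lam]) auto
    have "lam ` {a..r} \<subseteq> {u0..lam r}"
      using lam_ge_u0 lam_increase[of _ r] by fastforce
    then show "continuous_on {a..r} \<Phi>"
      unfolding \<Phi>_def using c
      by (intro continuous_intros continuous_on_compose2[OF continuous_on_G cl]
          continuous_on_compose2[OF continuous_on_F[of "lam r"] cl]) auto
    fix s assume s: "s \<in> {a<..<r}"
    have us: "u0 < lam s"
      using lam_increase[of a s] lam_a' s by simp
    then have l0: "0 < lam s"
      using u0_nonneg by simp
    have "(lam has_real_derivative lam_d m n lam s) (at s within {a..})"
      using s by (intro lam_ode) auto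
    moreover have "at s within {a..} = at s"
      using s by (intro at_within_interior) auto
    ultimately have ld: "(lam has_real_derivative lam_d m n lam s) (at s)"
      by simp
    have hp: "0 < h (lam s)"
      by (rule h_pos[OF us])
    have GF: "((\<lambda>t. (G t - (real n + 1) * F t) / c) has_real_derivative 1 / h (lam s)) (at (lam s))"
    proof (rule DERIV_cong[OF DERIV_cdivide[OF DERIV_diff[OF G_deriv[OF us] DERIV_cmult[OF F_deriv[OF us]]]]])
      have "(real n + 1) * (h (lam s) * lam s ^ (n - 1) + m / 2 / h (lam s)) - (real n + 1) * (h (lam s) * lam s ^ (n - 1))
          = c / h (lam s)"
        by (simp add: c_def distrib_left distrib_right mult.commute)
      then show "((real n + 1) * (h (lam s) * lam s ^ (n - 1) + m / 2 / h (lam s)) - (real n + 1) * (h (lam s) * lam s ^ (n - 1))) / c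
          = 1 / h (lam s)"
        using c by simp
    qed
    have "(\<Phi> has_real_derivative 1 / h (lam s) * lam_d m n lam s) (at s)"
      unfolding \<Phi>_def using DERIV_chain2[OF GF ld] by simp
    moreover have "1 / h (lam s) * lam_d m n lam s = lam_d m n lam s / (lam s ^ n * sqrt ((lam_d m n lam s)\<^sup>2 - 1)) * lam s ^ n"
      using l0 hp lam_d_eq_h[of s] us by simp
    ultimately show "(\<Phi> has_vector_derivative lam_d m n lam s / (lam s ^ n * sqrt ((lam_d m n lam s)\<^sup>2 - 1)) * lam s ^ n) (at s)"
      by (simp only: has_real_derivative_iff_has_vector_derivative)
  qed
  moreover have "\<Phi> a = 0"
    by (simp add: \<Phi>_def lam_a' G_u0 F_u0)
  ultimately have "c * integral {a..r} (\<lambda>s. lam_d m n lam s / (lam s ^ n * sqrt ((lam_d m n lam s)\<^sup>2 - 1)) * lam s ^ n) = c * \<Phi> r"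
    by (simp only: integral_unique diff_zero)
  also have "c * \<Phi> r = G (lam r) - (real n + 1) * F (lam r)"
    using c by (simp add: \<Phi>_def)
  finally show ?thesis
    by (simp only: c_def)
qed

text \<open>The difference is the radial integral of \<open>integral_second\<close>, whose integrand
  is non-negative. This gives A \<ge> 0, so that A \<le> int G can be squared.\<close>

lemma F_le_G:
  assumes "u0 \<le> t"
  shows "(real n + 1) * F t \<le> G t"
proof -
  obtain r where r: "a \<le> r" "lam r = t"
    using lam_surj[OF assms] .
  let ?f = "\<lambda>s. lam_d m n lam s / (lam s ^ n * sqrt ((lam_d m n lam s)\<^sup>2 - 1)) * lam s ^ n"
  have "0 \<le> ?f s" if "s \<in> {a..r}" for s
  proof -
    have us: "u0 \<le> lam s"
      using that by (intro lam_ge_u0) simp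
    show ?thesis
      using us u0_nonneg by (simp add: lam_d_eq_h[OF us])
  qed
  \<comment> \<open>A non-integrable function has integral 0 by convention, which covers m =
    0.\<close>
  then have "0 \<le> integral {a..r} ?f"
    by (cases "?f integrable_on {a..r}") (auto intro: integral_nonneg simp: not_integrable_integral)
  then have "0 \<le> m * (real n + 1) / 2 * integral {a..r} ?f"
    using m by simp
  then show ?thesis
    unfolding integral_second[OF r(1)] r(2) by simp
qed

end

section \<open>The weighted isoperimetric inequality\<close>

text \<open>The triangle inequality for the integral of the plane vector (f, g): project onto the
  direction of the total integral and apply Cauchy-Schwarz pointwise.\<close>

lemma sphere_int_Pythagoras:
  fixes f g :: "'a::euclidean_space \<Rightarrow> real"
  assumes f: "continuous_on (sphere 0 1) f" and g: "continuous_on (sphere 0 1) g"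
  shows "(sphere_int f)\<^sup>2 + (sphere_int g)\<^sup>2 \<le> (sphere_int (\<lambda>\<theta>. sqrt ((f \<theta>)\<^sup>2 + (g \<theta>)\<^sup>2)))\<^sup>2"
    and "(sphere_int f)\<^sup>2 + (sphere_int g)\<^sup>2 = (sphere_int (\<lambda>\<theta>. sqrt ((f \<theta>)\<^sup>2 + (g \<theta>)\<^sup>2)))\<^sup>2 \<Longrightarrow>
      \<theta> \<in> sphere 0 1 \<Longrightarrow> f \<theta> * sphere_int g = g \<theta> * sphere_int f"
proof -
  let ?f = "sphere_int f" and ?g = "sphere_int g"
  let ?s = "\<lambda>\<theta>. sqrt ((f \<theta>)\<^sup>2 + (g \<theta>)\<^sup>2)"
  let ?I = "sphere_int ?s"
  define R where "R = sqrt (?f\<^sup>2 + ?g\<^sup>2)"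
  have R2: "R\<^sup>2 = ?f\<^sup>2 + ?g\<^sup>2" and R0: "0 \<le> R"
    by (auto simp: R_def)
  have sc: "continuous_on (sphere 0 1) ?s"
    by (intro continuous_intros f g)
  \<comment> \<open>\<open>d\<close> is the pointwise Cauchy-Schwarz deficit against the vector (int
    f, int g) of length R. Its integral is R I - R^2, so equality forces d = 0 everywhere by
    continuity, and this is proportionality.\<close>
  define d where "d \<theta> = R * ?s \<theta> - (?f * f \<theta> + ?g * g \<theta>)" for \<theta>
  have dc: "continuous_on (sphere 0 1) d"
    unfolding d_def by (intro continuous_intros f g)
  have d0: "0 \<le> d \<theta>" for \<theta>
  proof -
    have "(?f * f \<theta> + ?g * g \<theta>)\<^sup>2 + (?f * g \<theta> - ?g * f \<theta>)\<^sup>2 = (?f\<^sup>2 + ?g\<^sup>2) * ((f \<theta>)\<^sup>2 + (g \<theta>)\<^sup>2)"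
      by (simp add: power2_eq_square algebra_simps)
    then have "(?f * f \<theta> + ?g * g \<theta>)\<^sup>2 \<le> (?f\<^sup>2 + ?g\<^sup>2) * ((f \<theta>)\<^sup>2 + (g \<theta>)\<^sup>2)"
      using zero_le_power2[of "?f * g \<theta> - ?g * f \<theta>"] by linarith
    then have "?f * f \<theta> + ?g * g \<theta> \<le> sqrt ((?f\<^sup>2 + ?g\<^sup>2) * ((f \<theta>)\<^sup>2 + (g \<theta>)\<^sup>2))"
      by (rule real_le_rsqrt)
    then show ?thesis
      by (simp add: d_def R_def real_sqrt_mult)
  qed
  have id: "sphere_int d = R * ?I - R\<^sup>2"
  proof -
    have "sphere_int d = sphere_int (\<lambda>\<theta>. R * ?s \<theta>) - sphere_int (\<lambda>\<theta>. ?f * f \<theta> + ?g * g \<theta>)"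
      unfolding d_def by (intro sphere_int_diff continuous_intros f g)
    also have "sphere_int (\<lambda>\<theta>. ?f * f \<theta> + ?g * g \<theta>) = sphere_int (\<lambda>\<theta>. ?f * f \<theta>) + sphere_int (\<lambda>\<theta>. ?g * g \<theta>)"
      by (intro sphere_int_add continuous_intros f g)
    finally show ?thesis
      unfolding R2 by (simp only: sphere_int_cmult power2_eq_square)
  qed
  have "0 \<le> sphere_int d"
    by (rule sphere_int_nonneg[OF dc]) (rule d0)
  then have "R * R \<le> R * ?I"
    by (simp add: id power2_eq_square)
  moreover have I0: "0 \<le> ?I"
    by (rule sphere_int_nonneg[OF sc]) simp
  ultimately have RI: "R \<le> ?I"
    using R0 by (cases "R = 0") auto
  show "?f\<^sup>2 + ?g\<^sup>2 \<le> ?I\<^sup>2"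
    unfolding R2[symmetric] by (rule power_mono[OF RI R0])
  show "f \<theta> * ?g = g \<theta> * ?f" if eq: "?f\<^sup>2 + ?g\<^sup>2 = ?I\<^sup>2" and \<theta>: "\<theta> \<in> sphere 0 1"
  proof -
    have "R = ?I"
      using eq R0 I0 unfolding R2[symmetric] by (simp add: power2_eq_iff_nonneg)
    then have "sphere_int d = 0"
      unfolding id by (simp add: power2_eq_square)
    then have "d \<theta> = 0"
      using sphere_int_eq_0_imp[OF dc d0 _ \<theta>] by simp
    then have "(R * ?s \<theta>)\<^sup>2 = (?f * f \<theta> + ?g * g \<theta>)\<^sup>2"
      by (simp add: d_def)
    then have "(?f\<^sup>2 + ?g\<^sup>2) * ((f \<theta>)\<^sup>2 + (g \<theta>)\<^sup>2) = (?f * f \<theta> + ?g * g \<theta>)\<^sup>2"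
      by (simp add: power_mult_distrib R2)
    then have "(f \<theta> * ?g - g \<theta> * ?f)\<^sup>2 = 0"
      by (simp add: power2_eq_square algebra_simps)
    then show ?thesis
      by simp
  qed
qed

context ads_schwarzschild
begin

lemma continuous_on_lam_d: "continuous_on {a..} (lam_d m n lam)"
proof -
  have "continuous_on {a..} (\<lambda>s. sqrt (1 + (h (lam s))\<^sup>2))"
    by (intro continuous_intros continuous_on_compose2[OF continuous_on_h continuous_on_lam]) (auto simp: lam_ge_u0)
  then show ?thesis
    by (rule continuous_on_eq) (simp add: lam_d_eq_h lam_ge_u0)
qed

lemma weighted_isoperimetric:
  fixes r :: "'a::euclidean_space \<Rightarrow> real" and Dr :: "'a \<Rightarrow> 'a" and eta :: "real \<Rightarrow> real"
  assumes N: "DIM('a) = n + 1"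
    and r_ge: "\<And>\<theta>. \<theta> \<in> sphere 0 1 \<Longrightarrow> a \<le> r \<theta>"
    and r_der: "\<And>x. x \<noteq> 0 \<Longrightarrow> ((\<lambda>y. r (sgn y)) has_derivative (\<lambda>h. Dr x \<bullet> h)) (at x)"
    and Dr: "continuous_on (- {0}) Dr"
    and eta: "\<And>t. u0 \<le> t \<Longrightarrow>
       eta (omega TYPE('a) * integral {u0..t} (\<lambda>s. s ^ n))
         = omega TYPE('a) * integral {u0..t} (\<lambda>s. Lam m n lam a s * s ^ n)"
  defines "I \<equiv> surf_int n lam r Dr (lam_d m n lam)"
    and "A \<equiv> (real n + 1) * eta (dom_int n lam a r (lam_d m n lam))
             + m * (real n + 1) / 2 * dom_int n lam a r
                 (\<lambda>s. lam_d m n lam s / ((lam s) ^ n * sqrt ((lam_d m n lam s)\<^sup>2 - 1)))"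
    and "T \<equiv> ((real n + 1) * omega TYPE('a) powr (1 / real n) * dom_int n lam a r (lam_d m n lam)
             + omega TYPE('a) powr ((real n + 1) / real n) * m) powr (2 * real n / (real n + 1))"
  shows "A\<^sup>2 + T \<le> I\<^sup>2 \<and> (I\<^sup>2 = A\<^sup>2 + T \<longleftrightarrow> (\<exists>r0\<ge>a. \<forall>\<theta>\<in>sphere 0 1. r \<theta> = r0))"
proof -
  let ?S = "sphere (0::'a) 1"
  let ?w = "omega TYPE('a)"
  note w = omega_pos[where 'a = 'a]
  have sg: "sgn x \<in> ?S" if "x \<noteq> 0" for x :: 'a
    using that by (simp add: norm_sgn)
  have sgS: "sgn \<theta> = \<theta>" if "\<theta> \<in> ?S" for \<theta> :: 'a
    using that by (simp add: sgn_div_norm)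
  have rc0: "continuous_on (- {0}) (\<lambda>x. r (sgn x))"
    by (intro continuous_at_imp_continuous_on ballI has_derivative_continuous[OF r_der]) auto
  have rc: "continuous_on ?S r"
  proof (rule continuous_on_eq)
    show "continuous_on ?S (\<lambda>x. r (sgn x))"
      by (rule continuous_on_subset[OF rc0]) auto
  qed (use sgS in auto)
  define u where "u \<theta> = lam (r \<theta>)" for \<theta>
  define Du where "Du x = lam_d m n lam (r (sgn x)) *\<^sub>R Dr x" for x
  have u_ge: "u0 \<le> u \<theta>" if "\<theta> \<in> ?S" for \<theta>
    unfolding u_def by (rule lam_ge_u0[OF r_ge[OF that]])
  have u_nn: "0 \<le> u \<theta>" if "\<theta> \<in> ?S" for \<theta>
    using u_ge[OF that] u0_nonneg by simp
  have uc: "continuous_on ?S u"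
    unfolding u_def by (rule continuous_on_compose2[OF continuous_on_lam rc]) (use r_ge in auto)
  have u_der: "((\<lambda>y. u (sgn y)) has_derivative (\<lambda>h. Du x \<bullet> h)) (at x)" if x: "x \<noteq> 0" for x
  proof -
    \<comment> \<open>The chain rule is used within the complement of the origin, because where r =
      a the derivative of lambda is only one-sided, within \<open>{a..}\<close>.\<close>
    have "((\<lambda>y. r (sgn y)) has_derivative (\<lambda>h. Dr x \<bullet> h)) (at x within - {0})"
      using r_der[OF x] by (rule has_derivative_at_withinI)
    moreover have "(lam has_derivative (\<lambda>y. lam_d m n lam (r (sgn x)) * y)) (at (r (sgn x)) within (\<lambda>y. r (sgn y)) ` (- {0}))"
    proof (rule has_derivative_subset)
      show "(lam has_derivative (\<lambda>y. lam_d m n lam (r (sgn x)) * y)) (at (r (sgn x)) within {a..})"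
        using lam_ode[OF r_ge[OF sg[OF x]]] unfolding has_field_derivative_def .
      show "(\<lambda>y. r (sgn y)) ` (- {0}) \<subseteq> {a..}"
        using r_ge sg by auto
    qed
    ultimately have "((\<lambda>y. lam (r (sgn y))) has_derivative (\<lambda>h. lam_d m n lam (r (sgn x)) * (Dr x \<bullet> h))) (at x within - {0})"
      by (rule has_derivative_in_compose)
    moreover have "at x within - {0} = at x"
      using x by (intro at_within_open) auto
    ultimately show ?thesis
      by (simp add: u_def Du_def)
  qed
  have Duc: "continuous_on (- {0}) Du"
    unfolding Du_def
    by (intro continuous_intros continuous_on_compose2[OF continuous_on_lam_d rc0] Dr) (use r_ge sg in auto)
  have DucS: "continuous_on ?S Du"
    by (rule continuous_on_subset[OF Duc]) auto
  define g where "g \<theta> = G (u \<theta>)" for \<theta>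
  define H where "H \<theta> = u \<theta> ^ (n - 1) * sqrt ((u \<theta>)\<^sup>2 + (norm (Du \<theta>))\<^sup>2)" for \<theta>
  have gc: "continuous_on ?S g"
    unfolding g_def by (rule continuous_on_compose2[OF continuous_on_G uc]) (use u_ge in auto)
  have Hc: "continuous_on ?S H"
    unfolding H_def by (intro continuous_intros uc DucS)
  have Fc: "continuous_on ?S (\<lambda>\<theta>. F (u \<theta>))"
  proof -
    have "compact (u ` ?S)"
      by (intro compact_continuous_image uc compact_sphere)
    then obtain B where B: "\<And>\<theta>. \<theta> \<in> ?S \<Longrightarrow> norm (u \<theta>) \<le> B"
      using compact_imp_bounded[of "u ` ?S"] unfolding bounded_iff by blast
    show ?thesis
      by (rule continuous_on_compose2[OF continuous_on_F[of B] uc]) (use u_ge B in \<open>force simp: abs_le_iff\<close>)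
  qed
  have g_nn: "0 \<le> g \<theta>" if "\<theta> \<in> ?S" for \<theta>
    unfolding g_def by (rule G_nonneg[OF u_ge[OF that]])
  have H_nn: "0 \<le> H \<theta>" if "\<theta> \<in> ?S" for \<theta>
    using u_nn[OF that] by (simp add: H_def)
  define IG where "IG = sphere_int g"
  define IH where "IH = sphere_int H"
  have IG0: "0 \<le> IG" and IH0: "0 \<le> IH"
    unfolding IG_def IH_def by (intro sphere_int_nonneg gc Hc g_nn H_nn; assumption)+

  have I_eq: "I = sphere_int (\<lambda>\<theta>. sqrt ((g \<theta>)\<^sup>2 + (H \<theta>)\<^sup>2))"
    unfolding I_def surf_int_def
  proof (rule sphere_int_cong)
    fix \<theta> assume \<theta>: "\<theta> \<in> ?S"
    define l where "l = lam_d m n lam (r \<theta>)"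
    have l: "l = sqrt (1 + (h (u \<theta>))\<^sup>2)"
      unfolding l_def u_def by (rule lam_d_eq_h[OF lam_ge_u0[OF r_ge[OF \<theta>]]])
    then have l0: "0 \<le> l" and l2: "l\<^sup>2 = 1 + (h (u \<theta>))\<^sup>2"
      by auto
    have nD: "norm (Du \<theta>) = l * norm (Dr \<theta>)"
      using l0 sgS[OF \<theta>] by (simp add: Du_def l_def)
    have "g \<theta> = u \<theta> ^ (n - 1) * (u \<theta> * h (u \<theta>))"
      using n unfolding g_def G_def by (simp add: power_eq_if)
    then have "(g \<theta>)\<^sup>2 + (H \<theta>)\<^sup>2 = (u \<theta> ^ (n - 1))\<^sup>2 * ((u \<theta> * h (u \<theta>))\<^sup>2 + (u \<theta>)\<^sup>2 + (norm (Du \<theta>))\<^sup>2)"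
      by (simp add: H_def power_mult_distrib distrib_left)
    also have "(u \<theta> * h (u \<theta>))\<^sup>2 + (u \<theta>)\<^sup>2 + (norm (Du \<theta>))\<^sup>2 = l\<^sup>2 * ((u \<theta>)\<^sup>2 + (norm (Dr \<theta>))\<^sup>2)"
      unfolding nD power_mult_distrib l2 by (simp add: algebra_simps)
    finally have "sqrt ((g \<theta>)\<^sup>2 + (H \<theta>)\<^sup>2) = u \<theta> ^ (n - 1) * (l * sqrt ((u \<theta>)\<^sup>2 + (norm (Dr \<theta>))\<^sup>2))"
      using l0 u_nn[OF \<theta>] by (simp add: real_sqrt_mult)
    then show "lam_d m n lam (r \<theta>) * lam (r \<theta>) ^ (n - 1) * sqrt ((lam (r \<theta>))\<^sup>2 + (norm (Dr \<theta>))\<^sup>2)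
        = sqrt ((g \<theta>)\<^sup>2 + (H \<theta>)\<^sup>2)"
      by (simp add: l_def u_def)
  qed

  define V where "V = sphere_int (\<lambda>\<theta>. u \<theta> ^ (n + 1))"
  have uNc: "continuous_on ?S (\<lambda>\<theta>. u \<theta> ^ (n + 1))"
    by (intro continuous_intros uc)
  \<comment> \<open>Together with u0^(n+1) = m this places \<open>U\<close> below in the range where
    F and the equation for eta are available.\<close>
  have V_ge: "m * ?w \<le> V"
    unfolding V_def sphere_int_const[symmetric]
    by (rule sphere_int_mono[OF _ uNc]) (use power_ge_m u_ge in auto)
  then have V0: "0 \<le> V"
    using m w by (meson less_imp_le mult_nonneg_nonneg order_trans)
  have D1: "dom_int n lam a r (lam_d m n lam) = (V - m * ?w) / (real n + 1)"
  proof -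
    have "dom_int n lam a r (lam_d m n lam) = sphere_int (\<lambda>\<theta>. 1 / (real n + 1) * (u \<theta> ^ (n + 1) - m))"
      unfolding dom_int_def by (rule sphere_int_cong) (simp add: integral_lam_d_power r_ge u_def)
    also have "\<dots> = 1 / (real n + 1) * (V - m * ?w)"
      unfolding sphere_int_cmult V_def
      using sphere_int_diff[OF uNc continuous_on_const[of _ m]] by (simp add: sphere_int_const)
    finally show ?thesis
      by simp
  qed
  have D2: "m * (real n + 1) / 2 * dom_int n lam a r
      (\<lambda>s. lam_d m n lam s / ((lam s) ^ n * sqrt ((lam_d m n lam s)\<^sup>2 - 1)))
    = IG - (real n + 1) * sphere_int (\<lambda>\<theta>. F (u \<theta>))"
  proof -
    have "m * (real n + 1) / 2 * dom_int n lam a r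
        (\<lambda>s. lam_d m n lam s / ((lam s) ^ n * sqrt ((lam_d m n lam s)\<^sup>2 - 1)))
      = sphere_int (\<lambda>\<theta>. g \<theta> - (real n + 1) * F (u \<theta>))"
      unfolding dom_int_def sphere_int_cmult[symmetric] g_def u_def
      by (rule sphere_int_cong) (rule integral_second[OF r_ge])
    also have "\<dots> = IG - sphere_int (\<lambda>\<theta>. (real n + 1) * F (u \<theta>))"
      unfolding IG_def by (intro sphere_int_diff gc continuous_intros Fc)
    finally show ?thesis
      by (simp only: sphere_int_cmult)
  qed
  \<comment> \<open>\<open>U\<close> is the value of lambda on the slice that encloses the same
    integral of lambda' dv as the given domain; there the equation for eta applies.\<close>
  define U where "U = root (n + 1) (V / ?w)"
  have UN: "U ^ (n + 1) = V / ?w"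
    unfolding U_def using V0 w by (intro real_root_pow_pos2) auto
  have U_ge: "u0 \<le> U"
  proof -
    have "u0 ^ (n + 1) \<le> U ^ (n + 1)"
      unfolding UN u0_power using V_ge w by (simp add: pos_le_divide_eq)
    moreover have "0 \<le> U"
      using V0 w by (simp add: U_def)
    ultimately show ?thesis
      using power_le_imp_le_base[of u0 n U] by simp
  qed
  have etaV: "eta (dom_int n lam a r (lam_d m n lam)) = ?w * F U"
  proof -
    have "dom_int n lam a r (lam_d m n lam) = ?w * integral {u0..U} (\<lambda>s. s ^ n)"
      unfolding D1 integral_power[OF U_ge] UN using w by (simp add: right_diff_distrib mult.commute)
    then show ?thesis
      using eta[OF U_ge] integral_Lam by simp
  qed
  have A_eq: "A = (real n + 1) * (?w * F U) + (IG - (real n + 1) * sphere_int (\<lambda>\<theta>. F (u \<theta>)))"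
    unfolding A_def etaV D2 ..
  have Jensen: "?w * F U \<le> sphere_int (\<lambda>\<theta>. F (u \<theta>))"
  proof -
    \<comment> \<open>The tangent is taken at \<open>U\<close>: since U^(n+1) is the mean of
      u^(n+1), the linear term integrates to 0.\<close>
    define K where "K = h U / U / (real n + 1)"
    have "sphere_int (\<lambda>\<theta>. F U + K * (u \<theta> ^ (n + 1) - U ^ (n + 1))) \<le> sphere_int (\<lambda>\<theta>. F (u \<theta>))"
    proof (rule sphere_int_mono)
      show "F U + K * (u \<theta> ^ (n + 1) - U ^ (n + 1)) \<le> F (u \<theta>)" if "\<theta> \<in> ?S" for \<theta>
        unfolding K_def by (rule F_tangent[OF u_ge[OF that] U_ge])
    qed (intro continuous_intros uc Fc)+
    moreover have "sphere_int (\<lambda>\<theta>. F U + K * (u \<theta> ^ (n + 1) - U ^ (n + 1))) = F U * ?w + K * (V - U ^ (n + 1) * ?w)"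
    proof -
      have "sphere_int (\<lambda>\<theta>. F U + K * (u \<theta> ^ (n + 1) - U ^ (n + 1)))
          = sphere_int (\<lambda>\<theta>::'a. F U) + sphere_int (\<lambda>\<theta>. K * (u \<theta> ^ (n + 1) - U ^ (n + 1)))"
        by (intro sphere_int_add continuous_intros uc)
      also have "sphere_int (\<lambda>\<theta>. K * (u \<theta> ^ (n + 1) - U ^ (n + 1))) = K * (V - sphere_int (\<lambda>\<theta>::'a. U ^ (n + 1)))"
        unfolding sphere_int_cmult V_def by (subst sphere_int_diff[OF uNc continuous_on_const]) simp
      finally show ?thesis
        by (simp only: sphere_int_const)
    qed
    moreover have "V - U ^ (n + 1) * ?w = 0"
      unfolding UN using w by simp
    ultimately show ?thesis
      by (simp add: mult.commute)
  qed
  have A_le: "A \<le> IG"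
    using mult_left_mono[OF Jensen, of "real n + 1"] unfolding A_eq by simp
  have A0: "0 \<le> A"
  proof -
    have F0: "0 \<le> F U"
      unfolding F_def
    proof (rule integral_nonneg)
      show "(\<lambda>s. h s * s ^ (n - 1)) integrable_on {u0..U}"
        by (intro integrable_continuous_real continuous_on_subset[OF continuous_on_F_integrand]) auto
    qed (use h_nonneg u0_nonneg in auto)
    have "sphere_int (\<lambda>\<theta>. (real n + 1) * F (u \<theta>)) \<le> sphere_int g"
      by (rule sphere_int_mono[OF _ gc]) (use F_le_G u_ge in \<open>auto simp: g_def intro!: continuous_intros Fc\<close>)
    then have "0 \<le> IG - (real n + 1) * sphere_int (\<lambda>\<theta>. F (u \<theta>))"
      by (simp only: sphere_int_cmult IG_def diff_ge_0_iff_ge)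
    then show ?thesis
      unfolding A_eq using F0 w by simp
  qed
  \<comment> \<open>The isoperimetric lower bound for \<open>IH\<close>. Its square is
    \<open>T\<close>, since n + 1 times the domain integral of lambda' is V - m \<omega>.\<close>
  define b where "b = root (n + 1) ?w * root (n + 1) V ^ n"
  have b0: "0 \<le> b"
    using w V0 by (simp add: b_def)
  have b_le: "b \<le> IH"
  proof -
    have "2 \<le> DIM('a)"
      using N n by simp
    from isoperimetric_star[OF this u_der Duc u_nn uc]
    show ?thesis
      unfolding N b_def V_def IH_def H_def by simp
  qed
  have T_eq: "T = b\<^sup>2"
  proof -
    have wp: "?w powr ((real n + 1) / real n) = ?w powr (1 / real n) * ?w"
      using n w by (simp add: add_divide_distrib powr_add)
    have "(real n + 1) * ?w powr (1 / real n) * dom_int n lam a r (lam_d m n lam) + ?w powr ((real n + 1) / real n) * m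
        = ?w powr (1 / real n) * V"
    proof -
      have e: "(real n + 1) * ?w powr (1 / real n) * dom_int n lam a r (lam_d m n lam) = ?w powr (1 / real n) * (V - m * ?w)"
        unfolding D1 by simp
      show ?thesis
        unfolding wp e by (simp add: algebra_simps)
    qed
    then have T1: "T = (?w powr (1 / real n) * V) powr (2 * real n / (real n + 1))"
      by (simp only: T_def)
    show ?thesis
    \<comment> \<open>A root is rewritten as \<open>powr\<close> for a positive base; for V = 0 both
      sides are 0.\<close>
    proof (cases "V = 0")
      case True
      then show ?thesis
        using n by (simp add: T1 b_def)
    next
      case False
      then have Vp: "0 < V" using V0 by simp
      have e1: "root (n + 1) ?w = ?w powr (1 / (real n + 1))" "root (n + 1) V = V powr (1 / (real n + 1))"
        using w Vp by (simp_all add: root_powr_inverse add.commute)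
      have "b = ?w powr (1 / (real n + 1)) * V powr (real n / (real n + 1))"
        unfolding b_def e1 using Vp by (simp add: powr_realpow[symmetric] powr_powr)
      then have "b\<^sup>2 = (?w powr (1 / (real n + 1)))\<^sup>2 * (V powr (real n / (real n + 1)))\<^sup>2"
        by (simp add: power_mult_distrib)
      also have "\<dots> = ?w powr (2 / (real n + 1)) * V powr (2 * real n / (real n + 1))"
        by (simp add: power2_eq_square powr_add[symmetric])
      also have "\<dots> = T"
        unfolding T1 using w Vp n by (simp add: powr_mult powr_powr)
      finally show ?thesis by simp
    qed
  qed
  have main: "A\<^sup>2 \<le> IG\<^sup>2" "T \<le> IH\<^sup>2"
    unfolding T_eq using A0 A_le b0 b_le by (auto intro: power_mono)
  note pyth = sphere_int_Pythagoras[OF gc Hc, folded I_eq IG_def IH_def]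
  have ineq: "A\<^sup>2 + T \<le> I\<^sup>2"
    using main pyth(1) by linarith
  \<comment> \<open>The homogeneous extension turns a maximum on the sphere into one on the open set
    of non-zero vectors, where the derivative must vanish.\<close>
  have Du_0: "Du \<theta> = 0" if \<theta>: "\<theta> \<in> ?S" and max: "\<And>\<theta>'. \<theta>' \<in> ?S \<Longrightarrow> u \<theta>' \<le> u \<theta>" for \<theta>
  proof -
    have "\<theta> \<noteq> 0" using \<theta> by auto
    have "(\<lambda>h. Du \<theta> \<bullet> h) = (\<lambda>h. 0)"
    proof (rule differential_zero_maxmin)
      show "\<theta> \<in> - {0}" "open (- {0::'a})"
        using \<open>\<theta> \<noteq> 0\<close> by auto
      show "((\<lambda>y. u (sgn y)) has_derivative (\<lambda>h. Du \<theta> \<bullet> h)) (at \<theta>)"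
        by (rule u_der[OF \<open>\<theta> \<noteq> 0\<close>])
      show "(\<forall>y\<in>- {0}. u (sgn y) \<le> u (sgn \<theta>)) \<or> (\<forall>y\<in>- {0}. u (sgn \<theta>) \<le> u (sgn y))"
        using max sg sgS[OF \<theta>] by simp
    qed
    then have "Du \<theta> \<bullet> Du \<theta> = 0"
      by metis
    then show ?thesis
      by simp
  qed
  have un: "x ^ n = x * x ^ (n - 1)" for x :: real
    using n by (simp add: power_eq_if)
  have const: "\<exists>r0\<ge>a. \<forall>\<theta>\<in>?S. r \<theta> = r0" if eq: "I\<^sup>2 = A\<^sup>2 + T"
  proof -
    have "IG\<^sup>2 + IH\<^sup>2 = I\<^sup>2"
      using eq main pyth(1) by linarith
    note proport = pyth(2)[OF this]
    have "?S \<noteq> {}" by simp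
    obtain \<theta>1 where \<theta>1: "\<theta>1 \<in> ?S" and max: "\<And>\<theta>. \<theta> \<in> ?S \<Longrightarrow> u \<theta> \<le> u \<theta>1"
      using continuous_attains_sup[OF compact_sphere \<open>?S \<noteq> {}\<close> uc] by blast
    define c where "c = u \<theta>1"
    have "u \<theta> = c" if \<theta>: "\<theta> \<in> ?S" for \<theta>
    \<comment> \<open>If the maximum is u0, then u is squeezed between u0 and c. Otherwise the
      maximum point fixes the ratio IG / IH = h(c).\<close>
    proof (cases "c = u0")
      case True
      then show ?thesis
        using max[OF \<theta>] u_ge[OF \<theta>] by (simp add: c_def)
    next
      case False
      then have cu: "u0 < c"
        using u_ge[OF \<theta>1] by (simp add: c_def)
      then have c0: "0 < c" using u0_nonneg by simp
      have H1: "H \<theta>1 = c ^ n"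
        using c0 Du_0[OF \<theta>1 max] un[of c] by (simp add: H_def c_def[symmetric])
      have "IH \<noteq> 0"
      proof
        assume "IH = 0"
        then have "H \<theta>1 = 0"
          using sphere_int_eq_0_imp[OF Hc H_nn _ \<theta>1] by (simp add: IH_def)
        then show False
          using H1 c0 by simp
      qed
      then have IHp: "0 < IH" using IH0 by simp
      have "c ^ n * (h c * IH) = c ^ n * IG"
        using proport[OF \<theta>1] unfolding H1 by (simp add: g_def G_def c_def)
      then have IG_eq: "IG = h c * IH"
        using c0 by simp
      \<comment> \<open>H \<ge> u^n and proportionality give u^n h(c) \<le> u^n h(u). As h is
        strictly increasing and u \<le> c, either u = c or u = 0.\<close>
      have dich: "u \<theta>' = 0 \<or> u \<theta>' = c" if \<theta>': "\<theta>' \<in> ?S" for \<theta>'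
      proof (rule disjCI)
        assume ne: "u \<theta>' \<noteq> c"
        let ?u = "u \<theta>'"
        have uc': "?u < c"
          using max[OF \<theta>'] ne by (simp add: c_def)
        have "sqrt (?u\<^sup>2) \<le> sqrt (?u\<^sup>2 + (norm (Du \<theta>'))\<^sup>2)"
          by simp
        then have "?u ^ n \<le> H \<theta>'"
          unfolding H_def un[of ?u] using u_nn[OF \<theta>'] by (simp add: mult_left_mono mult.commute[of ?u])
        then have "?u ^ n * IG \<le> H \<theta>' * IG"
          using IG0 by (rule mult_right_mono)
        also have "\<dots> = ?u ^ n * h ?u * IH"
          using proport[OF \<theta>'] by (simp add: g_def G_def)
        finally have "(?u ^ n * h c) * IH \<le> (?u ^ n * h ?u) * IH"
          unfolding IG_eq by (simp add: mult.assoc)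
        then have le: "?u ^ n * h c \<le> ?u ^ n * h ?u"
          using IHp by (rule mult_right_le_imp_le)
        have less: "h ?u < h c"
          by (rule h_strict_mono[OF u_ge[OF \<theta>'] uc'])
        show "?u = 0"
        proof (rule ccontr)
          assume "?u \<noteq> 0"
          then have "0 < ?u ^ n"
            using u_nn[OF \<theta>'] by simp
          then show False
            using mult_strict_left_mono[OF less, of "?u ^ n"] le by simp
        qed
      qed
      show ?thesis
      \<comment> \<open>The values 0 and c cannot both occur on the connected sphere, since c / 2
        would be attained as well.\<close>
      proof (rule ccontr)
        assume "u \<theta> \<noteq> c"
        then have z: "u \<theta> = 0"
          using dich[OF \<theta>] by simp
        have "2 \<le> DIM('a)"
          using N n by simp
        then have "connected (u ` ?S)"
          by (intro connected_continuous_image uc connected_sphere)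
        moreover have "0 \<in> u ` ?S" "c \<in> u ` ?S"
          using z \<theta> \<theta>1 by (auto simp: c_def image_iff)
        ultimately have "{0..c} \<subseteq> u ` ?S"
          by (rule connected_contains_Icc)
        moreover have "c / 2 \<in> {0..c}"
          using c0 by simp
        ultimately obtain \<theta>' where "\<theta>' \<in> ?S" "u \<theta>' = c / 2"
          by (metis imageE subsetD)
        then show False
          using dich c0 by force
      qed
    qed
    then have "lam (r \<theta>) = lam (r \<theta>1)" if "\<theta> \<in> ?S" for \<theta>
      using that by (simp add: u_def c_def)
    then have "r \<theta> = r \<theta>1" if "\<theta> \<in> ?S" for \<theta>
      using inj_onD[OF lam_inj] r_ge \<theta>1 that by (meson atLeast_iff)
    then show ?thesis
      using r_ge[OF \<theta>1] by blast
  qed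
  have conv: "I\<^sup>2 = A\<^sup>2 + T" if r0: "\<forall>\<theta>\<in>?S. r \<theta> = r0" for r0
  proof -
    define c where "c = lam r0"
    have uS: "u \<theta> = c" if "\<theta> \<in> ?S" for \<theta>
      using r0 that by (simp add: u_def c_def)
    have "?S \<noteq> {}" by simp
    then obtain \<theta>1 where \<theta>1: "\<theta>1 \<in> ?S"
      by (auto simp only: ex_in_conv[symmetric])
    have c_ge: "u0 \<le> c" and c0: "0 \<le> c"
      using u_ge[OF \<theta>1] u_nn[OF \<theta>1] uS[OF \<theta>1] by auto
    have gS: "g \<theta> = G c" if "\<theta> \<in> ?S" for \<theta>
      by (simp add: g_def uS[OF that])
    have HS: "H \<theta> = c ^ n" if \<theta>: "\<theta> \<in> ?S" for \<theta>
    proof -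
      \<comment> \<open>Every point is a maximum point of the constant \<open>u\<close>.\<close>
      have "Du \<theta> = 0"
        by (rule Du_0[OF \<theta>]) (simp only: uS \<theta>)
      then show ?thesis
        using c0 un[of c] by (simp add: H_def uS[OF \<theta>])
    qed
    have "IG = sphere_int (\<lambda>_::'a. G c)"
      unfolding IG_def by (rule sphere_int_cong) (rule gS)
    then have IGc: "IG = G c * ?w"
      by (simp only: sphere_int_const)
    have "IH = sphere_int (\<lambda>_::'a. c ^ n)"
      unfolding IH_def by (rule sphere_int_cong) (rule HS)
    then have IHc: "IH = c ^ n * ?w"
      by (simp only: sphere_int_const)
    have "I = sphere_int (\<lambda>_::'a. sqrt ((G c)\<^sup>2 + (c ^ n)\<^sup>2))"
      unfolding I_eq by (rule sphere_int_cong) (simp add: gS HS)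
    then have "I = sqrt ((G c)\<^sup>2 + (c ^ n)\<^sup>2) * ?w"
      by (simp only: sphere_int_const)
    then have "I\<^sup>2 = ((G c)\<^sup>2 + (c ^ n)\<^sup>2) * ?w\<^sup>2"
      by (simp add: power_mult_distrib)
    then have I2: "I\<^sup>2 = IG\<^sup>2 + IH\<^sup>2"
      unfolding IGc IHc by (simp add: power_mult_distrib distrib_right)
    have "V = sphere_int (\<lambda>_::'a. c ^ (n + 1))"
      unfolding V_def by (rule sphere_int_cong) (simp add: uS)
    then have Vc: "V = c ^ (n + 1) * ?w"
      by (simp only: sphere_int_const)
    have "U = root (n + 1) (c ^ (n + 1))"
      unfolding U_def Vc using w by simp
    also have "\<dots> = c"
      using c0 by (intro real_root_power_cancel) auto
    finally have Uc: "U = c" .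
    \<comment> \<open>On a slice U = c, so Jensen is an equality and A = IG.\<close>
    have "sphere_int (\<lambda>\<theta>. F (u \<theta>)) = sphere_int (\<lambda>_::'a. F c)"
      by (rule sphere_int_cong) (simp add: uS)
    then have "A = IG"
      unfolding A_eq Uc by (simp add: sphere_int_const mult.commute)
    moreover have "b = IH"
    proof -
      have "b = root (n + 1) ?w * (c * root (n + 1) ?w) ^ n"
        unfolding b_def Vc real_root_mult using c0 by (simp only: real_root_power_cancel[of "n + 1" c] zero_less_Suc Suc_eq_plus1)
      also have "\<dots> = c ^ n * root (n + 1) ?w ^ (n + 1)"
        by (simp add: power_mult_distrib)
      also have "root (n + 1) ?w ^ (n + 1) = ?w"
        using w by (intro real_root_pow_pos2) auto
      finally show ?thesis
        by (simp only: IHc)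
    qed
    ultimately show ?thesis
      using I2 T_eq by simp
  qed
  show ?thesis
    using ineq const conv by blast
qed

end

theorem theorem1p6:
  fixes lam :: "real \<Rightarrow> real" and m a :: real
    and r :: "'a::euclidean_space \<Rightarrow> real" and Dr :: "'a \<Rightarrow> 'a"
    and eta :: "real \<Rightarrow> real"
  defines "n \<equiv> DIM('a) - 1"
  assumes dim: "DIM('a) \<ge> 2"
    and m: "m \<ge> 0"
    and lam_ode: "\<forall>s\<ge>a. (lam has_real_derivative lam_d m n lam s) (at s within {a..})"
    and lam_a: "lam a = m powr (1 / (real n + 1))"
    and r_ge: "\<forall>\<theta>\<in>sphere 0 1. r \<theta> \<ge> a"
    and r_C1: "\<forall>x. x \<noteq> 0 \<longrightarrow>
                 ((\<lambda>y. r (y /\<^sub>R norm y)) has_derivative (\<lambda>h. Dr x \<bullet> h)) (at x)"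
    and r_C1_cont: "continuous_on (- {0}) Dr"
    and eta: "\<forall>t \<ge> m powr (1 / (real n + 1)).
       eta (omega TYPE('a) * integral {m powr (1 / (real n + 1))..t} (\<lambda>s. s ^ n))
         = omega TYPE('a) * integral {m powr (1 / (real n + 1))..t} (\<lambda>s. Lam m n lam a s * s ^ n)"
  shows "(surf_int n lam r Dr (lam_d m n lam))\<^sup>2 \<ge>
           ((real n + 1) * eta (dom_int n lam a r (lam_d m n lam))
             + m * (real n + 1) / 2 * dom_int n lam a r
                 (\<lambda>s. lam_d m n lam s / ((lam s) ^ n * sqrt ((lam_d m n lam s)\<^sup>2 - 1))))\<^sup>2
         + ((real n + 1) * omega TYPE('a) powr (1 / real n) * dom_int n lam a r (lam_d m n lam)
             + omega TYPE('a) powr ((real n + 1) / real n) * m) powr (2 * real n / (real n + 1))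
   \<and> ((surf_int n lam r Dr (lam_d m n lam))\<^sup>2 =
           ((real n + 1) * eta (dom_int n lam a r (lam_d m n lam))
             + m * (real n + 1) / 2 * dom_int n lam a r
                 (\<lambda>s. lam_d m n lam s / ((lam s) ^ n * sqrt ((lam_d m n lam s)\<^sup>2 - 1))))\<^sup>2
         + ((real n + 1) * omega TYPE('a) powr (1 / real n) * dom_int n lam a r (lam_d m n lam)
             + omega TYPE('a) powr ((real n + 1) / real n) * m) powr (2 * real n / (real n + 1))
         \<longleftrightarrow> (\<exists>r0\<ge>a. \<forall>\<theta>\<in>sphere 0 1. r \<theta> = r0))"
proof -
  have dn: "DIM('a) = n + 1" "1 \<le> n"
    using dim by (auto simp: n_def)
  interpret ads_schwarzschild n m a lam
    using dn m lam_ode lam_a by unfold_locales auto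
  show ?thesis
  proof (rule weighted_isoperimetric[OF dn(1)])
    show "((\<lambda>y. r (sgn y)) has_derivative (\<lambda>h. Dr x \<bullet> h)) (at x)" if "x \<noteq> 0" for x
      using r_C1 that by (simp add: sgn_div_norm)
  qed (use r_ge r_C1_cont eta in \<open>auto simp: u0_def\<close>)
qed

end
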